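(* Let $b:[0,\infty)\to\mathbb{R}$ be continuous with $b(0)\le 0$ and suppose $b\in\mathcal{B}$, i.e. there is $c<0$ such that for every $u<0$ one has $b(t)+ut>c$ for all sufficiently large $t$. Let $(W_t)_{t\ge0}$ be a standard Brownian motion started at $0$, let $\tau=\inf\{t>0:\ W_t\le b(t)\}$, assume $b$ is regular, i.e. $P(\tau=0)=0$, and let $F(t)=P(\tau\le t)$. Then for all complex $\alpha$ with $|\arg(\alpha)|\le \pi/2$, $$\int_0^{\infty}e^{-\alpha b(s)-\frac{\alpha^2}{2}s}\,F(ds)=1.$$
   Context: The integral is a Lebesgue–Stieltjes integral with respect to the distribution $F$ of $\tau$ on $(0,\infty)$. "Sufficiently large $t$" may depend on $u$. *)

theory Defs
  imports "HOL-Probability.Probability"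
begin

text \<open>Only the times \<open>t \<ge> 0\<close> of the process matter. All sample paths are continuous, so
  the hitting times below are measurable on an arbitrary (not necessarily complete) space.\<close>

locale standard_brownian_motion = prob_space M for M :: "'a measure" +
  fixes W :: "real \<Rightarrow> 'a \<Rightarrow> real"
  assumes rv: "0 \<le> t \<Longrightarrow> random_variable borel (W t)"
    and start: "AE \<omega> in M. W 0 \<omega> = 0"
    and indep_increments:
      "\<lbrakk>0 \<le> p 0; \<And>i. i < n \<Longrightarrow> p i < p (Suc i)\<rbrakk> \<Longrightarrow>
        indep_vars (\<lambda>_. borel) (\<lambda>i \<omega>. W (p (Suc i)) \<omega> - W (p i) \<omega>) {..<n :: nat}"
    and normal_increments:
      "\<lbrakk>0 \<le> s; s < t\<rbrakk> \<Longrightarrow>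
        distributed M lborel (\<lambda>\<omega>. W t \<omega> - W s \<omega>) (normal_density 0 (sqrt (t - s)))"
    and continuous_paths:
      "\<omega> \<in> space M \<Longrightarrow> continuous_on {0..} (\<lambda>t. W t \<omega>)"

text \<open>Extended-real valued: the value is \<open>\<infinity>\<close> if the path never meets the boundary.\<close>

definition first_passage :: "(real \<Rightarrow> 'a \<Rightarrow> real) \<Rightarrow> (real \<Rightarrow> real) \<Rightarrow> 'a \<Rightarrow> ereal" where
  "first_passage W b \<omega> = Inf (ereal ` {t. 0 < t \<and> W t \<omega> \<le> b t})"

definition regular_boundary ::
    "'a measure \<Rightarrow> (real \<Rightarrow> 'a \<Rightarrow> real) \<Rightarrow> (real \<Rightarrow> real) \<Rightarrow> bool" where
  "regular_boundary M W b \<longleftrightarrow> measure M {\<omega> \<in> space M. first_passage W b \<omega> = 0} = 0"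

definition passage_cdf ::
    "'a measure \<Rightarrow> (real \<Rightarrow> 'a \<Rightarrow> real) \<Rightarrow> (real \<Rightarrow> real) \<Rightarrow> real \<Rightarrow> real" where
  "passage_cdf M W b t = measure M {\<omega> \<in> space M. first_passage W b \<omega> \<le> ereal t}"

definition boundary_class :: "(real \<Rightarrow> real) set" where
  "boundary_class = {b. \<exists>c<0. \<forall>u<0. \<forall>\<^sub>F t in at_top. b t + u * t > c}"

end

theory Submission imports Defs begin

text \<open>
  For \<open>Re \<alpha> \<ge> 0\<close> the Wald martingale \<open>exp (- \<alpha> W\<^sub>t - \<alpha>\<^sup>2 t / 2)\<close> has mean 1. Stopping it at \<open>\<tau>\<close>
  rounded up to a grid of \<open>[0, T]\<close> preserves the mean. The stopped values are bounded in \<open>L\<^sup>2\<close>,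
  by the same fact for the real parameter \<open>2 Re \<alpha>\<close>, so refining the grid gives
  \<open>E[M\<^sub>\<tau>; \<tau> \<le> T] = E[M\<^sub>T; \<tau> \<le> T] = 1 - E[M\<^sub>T; \<tau> > T]\<close> without any maximal inequality.
  Since \<open>b\<close> grows faster than every linear function, Chernoff's bound for \<open>P(W\<^sub>T > b T)\<close> shows that
  \<open>P(\<tau> > T)\<close> is \<open>O(exp (- K T))\<close> for every \<open>K\<close>. As \<open>b\<close> is bounded below, this beats the growth
  \<open>exp ((Im \<alpha>)\<^sup>2 T / 2)\<close> of the martingale before \<open>\<tau>\<close>, and one lets \<open>T\<close> tend to infinity.
\<close>

section \<open>Normal moment generating function, uniform integrability, hitting events\<close>

text \<open>Before \<tau> the path stays above \<open>b\<close>, which is bounded below, so for Re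
  \<alpha> \<ge> 0 the modulus of the martingale is under control. Rounding \<tau> up loses this:
  between \<tau> and the next grid point the path may drop arbitrarily far, so the discretised
  values have no deterministic bound. The L2 bound replaces one, because |M_t|^2 equals exp
  (|\<alpha>|^2 t) times the Wald martingale with real parameter 2 Re \<alpha>, which is positive
  and has mean 1. The rounding is worth this price: a rule with finitely many values needs no
  continuous-time stopping theorem, only that M_t and M_T have equal integrals over each event of
  the past of t \<le> T. That in turn is independence of one increment from the past. Regularity
  makes \<tau> positive almost surely. A positive finite infimum is attained with equality W_\<tau>
  = b(\<tau>), and this is what turns M_\<tau> into the integrand, a function of \<tau>
  alone.\<close>

lemma normal_complex_mgf:
  fixes X :: "'a \<Rightarrow> real" and z :: complex
  assumes "prob_space M" "0 < \<sigma>" and X: "distributed M lborel X (normal_density 0 \<sigma>)"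
  shows "integrable M (\<lambda>\<omega>. exp (z * of_real (X \<omega>)))"
    and "(\<integral>\<omega>. exp (z * of_real (X \<omega>)) \<partial>M) = exp (z\<^sup>2 * of_real (\<sigma>\<^sup>2) / 2)"
proof -
  interpret prob_space M by fact
  define w where "w = z * of_real \<sigma>"
  define Z where "Z = (\<lambda>\<omega>. X \<omega> / \<sigma>)"
  have Z: "distributed M lborel Z std_normal_density"
    using normal_standard_normal_convert[OF \<open>0 < \<sigma>\<close>, of X 0] X by (simp add: Z_def)
  have Zm[measurable]: "Z \<in> borel_measurable M" using distributed_measurable[OF Z] by simp
  have zX: "z * of_real (X \<omega>) = w * of_real (Z \<omega>)" for \<omega>
    using \<open>0 < \<sigma>\<close> by (simp add: w_def Z_def)
  have distr: "distr M borel Z = std_normal_distribution"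
    using distributed_distr_eq_density[OF Z] by (metis distr_cong sets_lborel)
  define f where "f = (\<lambda>x. std_normal_density x *\<^sub>R exp (w * complex_of_real x))"
  \<comment> \<open>Completing the square in the real direction only: translation by
    \<open>Re w\<close> removes the real exponential, leaving an oscillation of frequency
    \<open>Im w\<close>. The characteristic function of the normal law then suffices, without
    analytic continuation.\<close>
  have shift: "f (Re w + 1 * x) = exp (w * of_real (Re w) - of_real ((Re w)\<^sup>2) / 2) *
      (std_normal_density x *\<^sub>R iexp (Im w * x))" for x
  proof -
    have "f (Re w + 1 * x) = of_real (1 / sqrt (2 * pi)) *
        exp (of_real (- (Re w + x)\<^sup>2 / 2) + w * complex_of_real (Re w + x))"
      unfolding f_def std_normal_density_def exp_add
      by (simp add: scaleR_conv_of_real flip: exp_of_real)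
    also have "of_real (- (Re w + x)\<^sup>2 / 2) + w * complex_of_real (Re w + x) =
       (w * of_real (Re w) - of_real ((Re w)\<^sup>2) / 2) + of_real (- x\<^sup>2/2) + \<i> * of_real (Im w * x)"
      by (simp add: complex_eq_iff power2_eq_square field_simps)
    finally show ?thesis
      unfolding exp_add by (simp add: std_normal_density_def scaleR_conv_of_real flip: exp_of_real)
  qed
  have int0: "integrable std_normal_distribution (\<lambda>x. iexp (Im w * x))"
  proof -
    interpret N: prob_space std_normal_distribution
      using prob_space_normal_density[of 1 0] by simp
    show ?thesis by (rule N.integrable_const_bound[where B=1]) auto
  qed
  have int1: "integrable lborel (\<lambda>x. std_normal_density x *\<^sub>R iexp (Im w * x))"
    using int0 by (subst (asm) integrable_density) auto
  have val1: "(\<integral>x. std_normal_density x *\<^sub>R iexp (Im w * x) \<partial>lborel) = of_real (exp (- (Im w)\<^sup>2 / 2))"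
    using char_std_normal_distribution[THEN fun_cong, of "Im w"] unfolding char_def
    by (subst (asm) integral_density) auto
  have "integrable lborel (\<lambda>x. f (Re w + 1 * x))"
    unfolding shift by (intro integrable_mult_right int1)
  then have intf: "integrable lborel f"
    using lborel_integrable_real_affine_iff[of 1 f "Re w"] by simp
  have "integral\<^sup>L lborel f = (\<integral>x. f (Re w + 1 * x) \<partial>lborel)"
    using lborel_integral_real_affine[of 1 f "Re w"] by simp
  also have "\<dots> = exp (w * of_real (Re w) - of_real ((Re w)\<^sup>2) / 2) * of_real (exp (- (Im w)\<^sup>2 / 2))"
    unfolding shift by (subst Bochner_Integration.integral_mult_right) (use int1 val1 in auto)
  also have "\<dots> = exp (w\<^sup>2 / 2)"
    unfolding exp_of_real[symmetric] exp_add[symmetric]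
    by (rule arg_cong[where f=exp]) (simp add: complex_eq_iff power2_eq_square field_simps)
  finally have valf: "integral\<^sup>L lborel f = exp (w\<^sup>2 / 2)" .
  have "integrable (distr M borel Z) (\<lambda>x. exp (w * complex_of_real x))"
    unfolding distr using intf unfolding f_def by (subst integrable_density) auto
  then show "integrable M (\<lambda>\<omega>. exp (z * of_real (X \<omega>)))"
    unfolding zX by (subst (asm) integrable_distr_eq) auto
  have "(\<integral>\<omega>. exp (w * of_real (Z \<omega>)) \<partial>M) = (\<integral>x. exp (w * complex_of_real x) \<partial>distr M borel Z)"
    by (subst integral_distr) auto
  also have "\<dots> = exp (w\<^sup>2 / 2)"
    unfolding distr using valf unfolding f_def by (subst integral_density) auto
  finally show "(\<integral>\<omega>. exp (z * of_real (X \<omega>)) \<partial>M) = exp (z\<^sup>2 * of_real (\<sigma>\<^sup>2) / 2)"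
    unfolding zX by (simp add: w_def power_mult_distrib)
qed

text \<open>L2-boundedness gives uniform integrability: the distance D to the limit is cut at a
  level R, dominated convergence treats the part below, and D \<le> D^2 / R bounds the part above.
  Boundedness of the limit puts D itself in L2 uniformly in n.\<close>

lemma (in prob_space) tendsto_expectation_L2_bounded:
  fixes X :: "nat \<Rightarrow> 'a \<Rightarrow> 'b::{banach, second_countable_topology}"
  assumes X[measurable]: "\<And>n. X n \<in> borel_measurable M" and Y[measurable]: "Y \<in> borel_measurable M"
    and lim: "AE \<omega> in M. (\<lambda>n. X n \<omega>) \<longlonglongrightarrow> Y \<omega>"
    and int: "\<And>n. integrable M (\<lambda>\<omega>. (norm (X n \<omega>))\<^sup>2)"
    and bound: "\<And>n. (\<integral>\<omega>. (norm (X n \<omega>))\<^sup>2 \<partial>M) \<le> C"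
    and Yb: "\<And>\<omega>. \<omega> \<in> space M \<Longrightarrow> norm (Y \<omega>) \<le> K"
  shows "(\<lambda>n. \<integral>\<omega>. X n \<omega> \<partial>M) \<longlonglongrightarrow> (\<integral>\<omega>. Y \<omega> \<partial>M)"
proof -
  have intX: "integrable M (X n)" for n
  proof (rule Bochner_Integration.integrable_bound)
    show "integrable M (\<lambda>\<omega>. 1 + (norm (X n \<omega>))\<^sup>2)" using int by simp
    have "x \<le> 1 + x\<^sup>2" for x :: real
      using zero_le_power2[of "x - 1/2"] by (simp add: power2_eq_square algebra_simps)
    then show "AE \<omega> in M. norm (X n \<omega>) \<le> norm (1 + (norm (X n \<omega>))\<^sup>2)" by simp
  qed simp
  have intY: "integrable M Y"
    by (rule integrable_const_bound[where B=K]) (use Yb in auto)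
  define D where "D n \<omega> = norm (X n \<omega> - Y \<omega>)" for n \<omega>
  have [measurable]: "D n \<in> borel_measurable M" for n unfolding D_def by measurable
  have D0: "0 \<le> D n \<omega>" for n \<omega> by (simp add: D_def)
  define B where "B = 2 * C + 2 * K\<^sup>2"
  have D2le: "(D n \<omega>)\<^sup>2 \<le> 2 * (norm (X n \<omega>))\<^sup>2 + 2 * K\<^sup>2" if "\<omega> \<in> space M" for n \<omega>
  proof -
    have "D n \<omega> \<le> norm (X n \<omega>) + K"
      unfolding D_def using norm_triangle_ineq4[of "X n \<omega>" "Y \<omega>"] Yb[OF that] by linarith
    then have "(D n \<omega>)\<^sup>2 \<le> (norm (X n \<omega>) + K)\<^sup>2" using D0 by (rule power_mono)
    also have "\<dots> \<le> 2 * (norm (X n \<omega>))\<^sup>2 + 2 * K\<^sup>2"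
      using zero_le_power2[of "norm (X n \<omega>) - K"] by (simp add: power2_eq_square algebra_simps)
    finally show ?thesis .
  qed
  have intD2: "integrable M (\<lambda>\<omega>. (D n \<omega>)\<^sup>2)" for n
    by (rule Bochner_Integration.integrable_bound[where f="\<lambda>\<omega>. 2 * (norm (X n \<omega>))\<^sup>2 + 2 * K\<^sup>2"])
       (use int D2le in auto)
  have D2: "(\<integral>\<omega>. (D n \<omega>)\<^sup>2 \<partial>M) \<le> B" for n
  proof -
    have "(\<integral>\<omega>. (D n \<omega>)\<^sup>2 \<partial>M) \<le> (\<integral>\<omega>. 2 * (norm (X n \<omega>))\<^sup>2 + 2 * K\<^sup>2 \<partial>M)"
      by (rule integral_mono) (use intD2 int D2le in auto)
    also have "\<dots> \<le> B" using bound[of n] int[of n] by (simp add: B_def prob_space)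
    finally show ?thesis .
  qed
  have B0: "0 \<le> B" using D2[of 0] by (meson Bochner_Integration.integral_nonneg order_trans zero_le_power2)
  have intD: "integrable M (D n)" for n
    unfolding D_def using intX intY by auto
  have trunc: "(\<lambda>n. \<integral>\<omega>. min (D n \<omega>) R \<partial>M) \<longlonglongrightarrow> 0" if "R > 0" for R
  proof -
    have "(\<lambda>n. \<integral>\<omega>. min (D n \<omega>) R \<partial>M) \<longlonglongrightarrow> (\<integral>\<omega>. 0 \<partial>M)"
    proof (rule integral_dominated_convergence[where w="\<lambda>_. R"])
      show "AE \<omega> in M. (\<lambda>n. min (D n \<omega>) R) \<longlonglongrightarrow> 0"
        using lim
      proof eventually_elim
        case (elim \<omega>)
        then have "(\<lambda>n. D n \<omega>) \<longlonglongrightarrow> 0"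
          unfolding D_def by (simp add: LIM_zero tendsto_norm_zero)
        then have "(\<lambda>n. min (D n \<omega>) R) \<longlonglongrightarrow> min 0 R" by (intro tendsto_min tendsto_const)
        then show ?case using that by simp
      qed
    qed (use that D0 in auto)
    then show ?thesis by simp
  qed
  have split: "(\<integral>\<omega>. D n \<omega> \<partial>M) \<le> (\<integral>\<omega>. min (D n \<omega>) R \<partial>M) + B / R" if "R > 0" for n R
  proof -
    have "(\<integral>\<omega>. D n \<omega> \<partial>M) \<le> (\<integral>\<omega>. min (D n \<omega>) R + (D n \<omega>)\<^sup>2 / R \<partial>M)"
    proof (rule integral_mono)
      show "integrable M (\<lambda>\<omega>. min (D n \<omega>) R + (D n \<omega>)\<^sup>2 / R)"
        using intD2 intD by auto
      fix \<omega>
      show "D n \<omega> \<le> min (D n \<omega>) R + (D n \<omega>)\<^sup>2 / R"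
      proof (cases "D n \<omega> \<le> R")
        case False
        then have "D n \<omega> * R \<le> (D n \<omega>)\<^sup>2" using D0[of n \<omega>] by (simp add: power2_eq_square mult_left_mono)
        then have "D n \<omega> \<le> (D n \<omega>)\<^sup>2 / R" using that by (simp add: field_simps)
        then show ?thesis using that False by simp
      qed (use that in simp)
    qed (fact intD)
    also have "\<dots> = (\<integral>\<omega>. min (D n \<omega>) R \<partial>M) + (\<integral>\<omega>. (D n \<omega>)\<^sup>2 \<partial>M) / R"
      using intD intD2 by simp
    also have "\<dots> \<le> (\<integral>\<omega>. min (D n \<omega>) R \<partial>M) + B / R"
      using D2[of n] that by (simp add: divide_right_mono)
    finally show ?thesis .
  qed
  have "(\<lambda>n. \<integral>\<omega>. D n \<omega> \<partial>M) \<longlonglongrightarrow> 0"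
  proof (rule LIMSEQ_I)
    fix e :: real assume "0 < e"
    \<comment> \<open>The summand 1 keeps R positive if B = 0 and makes B / R strictly smaller than
      e / 2.\<close>
    define R where "R = 2 * (B + 1) / e"
    have R: "R > 0" "B / R < e / 2" using B0 \<open>0 < e\<close> by (auto simp: R_def field_simps)
    from LIMSEQ_D[OF trunc[OF R(1)], of "e/2"] \<open>0 < e\<close>
    obtain N where N: "\<And>n. n \<ge> N \<Longrightarrow> \<bar>\<integral>\<omega>. min (D n \<omega>) R \<partial>M\<bar> < e / 2" by auto
    have "norm ((\<integral>\<omega>. D n \<omega> \<partial>M) - 0) < e" if "n \<ge> N" for n
    proof -
      have "0 \<le> (\<integral>\<omega>. D n \<omega> \<partial>M)" by (rule Bochner_Integration.integral_nonneg) (rule D0)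
      then show ?thesis using N[OF that] split[OF R(1), of n] R(2) by (simp only: real_norm_def)
    qed
    then show "\<exists>N. \<forall>n\<ge>N. norm ((\<integral>\<omega>. D n \<omega> \<partial>M) - 0) < e" by blast
  qed
  moreover have le: "norm ((\<integral>\<omega>. X n \<omega> \<partial>M) - (\<integral>\<omega>. Y \<omega> \<partial>M)) \<le> (\<integral>\<omega>. D n \<omega> \<partial>M)" for n
    unfolding D_def using intX intY integral_norm_bound[of M "\<lambda>\<omega>. X n \<omega> - Y \<omega>"] by simp
  ultimately have "(\<lambda>n. (\<integral>\<omega>. X n \<omega> \<partial>M) - (\<integral>\<omega>. Y \<omega> \<partial>M)) \<longlonglongrightarrow> 0"
    using Lim_null_comparison[OF always_eventually[OF allI[OF le]], of "\<lambda>n. n"] by simp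
  then show ?thesis by (rule LIM_zero_cancel)
qed

text \<open>The uncountable union over s becomes countable: a hit inside [1/(n+1), t] amounts, by
  compactness, to rational times there at which W - b is below every 1/(j+1). These rationals are
  found to the right of s, so a hit exactly at t is listed apart. Measurability is assumed only up
  to t so that the lemma also applies to the past of the process.\<close>

lemma hit_before_measurable:
  fixes W :: "real \<Rightarrow> 'a \<Rightarrow> real" and b :: "real \<Rightarrow> real"
  assumes W: "\<And>s. 0 \<le> s \<Longrightarrow> s \<le> t \<Longrightarrow> W s \<in> borel_measurable N"
    and cont: "\<And>\<omega>. \<omega> \<in> space N \<Longrightarrow> continuous_on {0..} (\<lambda>s. W s \<omega>)"
    and b: "continuous_on {0..} b"
  shows "{\<omega> \<in> space N. \<exists>s. 0 < s \<and> s \<le> t \<and> W s \<omega> \<le> b s} \<in> sets N"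
proof -
  define Q where "Q n = {q. real_of_rat q \<ge> 1 / Suc n \<and> real_of_rat q \<le> t}" for n
  have eq: "(\<exists>s. 0 < s \<and> s \<le> t \<and> W s \<omega> \<le> b s) \<longleftrightarrow>
      (W t \<omega> \<le> b t \<and> 0 < t) \<or> (\<exists>n. \<forall>j. \<exists>q\<in>Q n. W (real_of_rat q) \<omega> < b (real_of_rat q) + 1 / Suc j)"
    (is "?L \<longleftrightarrow> ?E \<or> ?R") if \<omega>: "\<omega> \<in> space N" for \<omega>
  proof
    define g where "g s = W s \<omega> - b s" for s
    have g: "continuous_on {0..} g" unfolding g_def by (intro continuous_intros cont \<omega> b)
    {
      assume ?L
      then obtain s where s: "0 < s" "s \<le> t" "g s \<le> 0" by (auto simp: g_def)
      show "?E \<or> ?R"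
      proof (cases "s = t")
        case True then show ?thesis using s by (simp add: g_def)
      next
        case False
        then have "s < t" using s by simp
        obtain n where n: "1 / Suc n < s"
          using nat_approx_posE[OF s(1)] by auto
        have "\<exists>q\<in>Q n. W (real_of_rat q) \<omega> < b (real_of_rat q) + 1 / Suc j" for j
        proof -
          have "isCont g s" using g s(1) by (simp add: continuous_on_interior)
          then have "(g \<longlongrightarrow> g s) (at_right s)" by (simp add: isCont_def filterlim_at_split)
          moreover have "g s < 1 / Suc j" using s(3) by (rule le_less_trans) simp
          ultimately have "\<forall>\<^sub>F x in at_right s. g x < 1 / Suc j" by (rule order_tendstoD)
          then obtain r where r: "r > s" "\<And>y. s < y \<Longrightarrow> y < r \<Longrightarrow> g y < 1 / Suc j"
            unfolding eventually_at_right_field by blast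
          obtain q where "s < real_of_rat q" "real_of_rat q < min r t"
            using of_rat_dense[of s "min r t"] r(1) \<open>s < t\<close> by auto
          then show ?thesis using r(2)[of "real_of_rat q"] n
            by (intro bexI[of _ q]) (auto simp: g_def Q_def)
        qed
        then show ?thesis by blast
      qed
    }
    {
      assume "?E \<or> ?R"
      then show ?L
      proof
        assume ?R
        then obtain n where n: "\<forall>j. \<exists>q\<in>Q n. W (real_of_rat q) \<omega> < b (real_of_rat q) + 1 / Suc j" by blast
        then have "\<forall>j. \<exists>q. q \<in> Q n \<and> W (real_of_rat q) \<omega> < b (real_of_rat q) + 1 / Suc j" by blast
        then obtain q where q: "\<forall>j. q j \<in> Q n \<and> W (real_of_rat (q j)) \<omega> < b (real_of_rat (q j)) + 1 / Suc j"
          by (rule choice[THEN exE])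
        define x where "x j = real_of_rat (q j)" for j
        have x: "x j \<in> {1 / Suc n..t}" "g (x j) < 1 / Suc j" for j
          using q[rule_format, of j] by (auto simp: Q_def g_def x_def)
        \<comment> \<open>The near-hits accumulate at an actual hit l; the lower end 1/(n+1), the
          same for all j, keeps l away from the forbidden time 0.\<close>
        obtain l r where l: "l \<in> {1 / Suc n..t}" "strict_mono r" "(x \<circ> r) \<longlonglongrightarrow> l"
          using compact_Icc[of "1 / Suc n" t] x(1) seq_compactE[of "{1 / Suc n..t}" x] unfolding compact_eq_seq_compact_metric by blast
        have "0 < l" using l(1) by (auto intro: less_le_trans[of 0 "1 / Suc n"])
        then have "isCont g l" using g by (simp add: continuous_on_interior)
        then have "(\<lambda>j. g ((x \<circ> r) j)) \<longlonglongrightarrow> g l" using l(3) by (rule isCont_tendsto_compose)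
        moreover have "(\<lambda>j. 1 / Suc (r j)) \<longlonglongrightarrow> (0::real)"
          using LIMSEQ_subseq_LIMSEQ[OF LIMSEQ_Suc[OF lim_1_over_n] l(2)] by (simp add: o_def)
        ultimately have "g l \<le> 0" by (rule LIMSEQ_le) (use x(2) in \<open>auto intro: less_imp_le\<close>)
        then show ?L using l(1) \<open>0 < l\<close> by (auto simp: g_def)
      qed auto
    }
  qed
  have WQ: "q \<in> Q n \<Longrightarrow> W (real_of_rat q) \<in> borel_measurable N" for q n
  proof -
    assume q: "q \<in> Q n"
    have "0 \<le> 1 / real (Suc n)" by simp
    also have "\<dots> \<le> real_of_rat q" using q by (simp add: Q_def)
    finally show "W (real_of_rat q) \<in> borel_measurable N" using q by (intro W) (auto simp: Q_def)
  qed
  have 1: "{\<omega> \<in> space N. W t \<omega> \<le> b t \<and> 0 < t} \<in> sets N"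
  proof (cases "0 < t")
    case True
    then have [measurable]: "W t \<in> borel_measurable N" by (intro W) auto
    show ?thesis by measurable
  qed simp
  have 2: "{\<omega> \<in> space N. \<exists>n. \<forall>j. \<exists>q\<in>Q n. W (real_of_rat q) \<omega> < b (real_of_rat q) + 1 / Suc j} \<in> sets N"
  proof -
    have "{\<omega> \<in> space N. q \<in> Q n \<and> W (real_of_rat q) \<omega> < b (real_of_rat q) + 1 / Suc j} \<in> sets N" for q n j
    proof (cases "q \<in> Q n")
      case True
      then have [measurable]: "W (real_of_rat q) \<in> borel_measurable N" by (rule WQ)
      show ?thesis by measurable
    qed simp
    then show ?thesis
      unfolding Bex_def by (intro sets.sets_Collect_countable_Ex sets.sets_Collect_countable_All)
  qed
  have "{\<omega> \<in> space N. \<exists>s. 0 < s \<and> s \<le> t \<and> W s \<omega> \<le> b s} =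
    {\<omega> \<in> space N. W t \<omega> \<le> b t \<and> 0 < t} \<union>
    {\<omega> \<in> space N. \<exists>n. \<forall>j. \<exists>q\<in>Q n. W (real_of_rat q) \<omega> < b (real_of_rat q) + 1 / Suc j}"
    using eq by blast
  then show ?thesis using 1 2 by simp
qed

section \<open>The past of Brownian motion and its independence of future increments\<close>

text \<open>Starting at 0 on every path makes grid values exactly sums of increments. The almost
  sure version is reduced to this one by subtracting \<open>W 0\<close>.\<close>

locale brownian_from_zero = standard_brownian_motion M W for M :: "'a measure" and W +
  assumes W_0: "W 0 = (\<lambda>_. 0)"
begin

text \<open>Dyadic grids are nested, so the cylinder sets over them form an intersection-stable generator
  without sorting arbitrary finite sets of times.\<close>

definition grid :: "real \<Rightarrow> nat \<Rightarrow> 'a \<Rightarrow> nat \<Rightarrow> real" where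
  "grid t m \<omega> = (\<lambda>i\<in>{..2 ^ m}. W (real i * t / 2 ^ m) \<omega>)"

definition cyl :: "real \<Rightarrow> nat \<Rightarrow> 'a set set" where
  "cyl t m = {grid t m -` A \<inter> space M | A. A \<in> sets (\<Pi>\<^sub>M i\<in>{..2 ^ m}. borel)}"

definition past :: "real \<Rightarrow> 'a measure" where
  "past t = sigma (space M) (\<Union>m. cyl t m)"

lemma grid_measurable: "0 \<le> t \<Longrightarrow> grid t m \<in> M \<rightarrow>\<^sub>M (\<Pi>\<^sub>M i\<in>{..2 ^ m}. borel)"
  unfolding grid_def by (intro measurable_restrict rv) simp

lemma cyl_events: "0 \<le> t \<Longrightarrow> cyl t m \<subseteq> events"
  using measurable_sets[OF grid_measurable] by (auto simp: cyl_def)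

text \<open>The even-indexed points of the finer grid are the coarser grid, so the coarse values are
  a measurable function of the fine ones.\<close>

lemma cyl_Suc: "cyl t m \<subseteq> cyl t (Suc m)"
proof
  fix a assume "a \<in> cyl t m"
  then obtain A where A: "A \<in> sets (\<Pi>\<^sub>M i\<in>{..2 ^ m}. borel)" "a = grid t m -` A \<inter> space M"
    unfolding cyl_def by blast
  define f where "f x = (\<lambda>i\<in>{..2 ^ m}. x (2 * i))" for x :: "nat \<Rightarrow> real"
  have f: "f \<in> (\<Pi>\<^sub>M i\<in>{..2 ^ Suc m}. borel) \<rightarrow>\<^sub>M (\<Pi>\<^sub>M i\<in>{..2 ^ m}. borel)"
    unfolding f_def by (intro measurable_restrict measurable_component_singleton) auto
  have *: "grid t m \<omega> = f (grid t (Suc m) \<omega>)" for \<omega>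
    by (auto simp: grid_def f_def fun_eq_iff restrict_def)
  have "grid t (Suc m) \<omega> \<in> space (\<Pi>\<^sub>M i\<in>{..2 ^ Suc m}. borel)" for \<omega>
    by (simp add: grid_def space_PiM)
  then have "a = grid t (Suc m) -` (f -` A \<inter> space (\<Pi>\<^sub>M i\<in>{..2 ^ Suc m}. borel)) \<inter> space M"
    unfolding A(2) by (auto simp: *)
  then show "a \<in> cyl t (Suc m)"
    unfolding cyl_def using measurable_sets[OF f A(1)] by blast
qed

lemma cyl_mono: "m \<le> n \<Longrightarrow> cyl t m \<subseteq> cyl t n"
  using lift_Suc_mono_le[of "cyl t", OF cyl_Suc] .

lemma Int_stable_cyl: "Int_stable (\<Union>m. cyl t m)"
proof (rule Int_stableI)
  fix a a' assume "a \<in> (\<Union>m. cyl t m)" "a' \<in> (\<Union>m. cyl t m)"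
  then obtain m m' where "a \<in> cyl t m" "a' \<in> cyl t m'" by blast
  then have "a \<in> cyl t (max m m')" "a' \<in> cyl t (max m m')"
    using cyl_mono[of m "max m m'" t] cyl_mono[of m' "max m m'" t] by auto
  then obtain A A' where "A \<in> sets (\<Pi>\<^sub>M i\<in>{..2 ^ max m m'}. borel)" "A' \<in> sets (\<Pi>\<^sub>M i\<in>{..2 ^ max m m'}. borel)"
    "a = grid t (max m m') -` A \<inter> space M" "a' = grid t (max m m') -` A' \<inter> space M"
    unfolding cyl_def by blast
  then have "a \<inter> a' \<in> cyl t (max m m')"
    unfolding cyl_def by (intro CollectI exI[of _ "A \<inter> A'"]) auto
  then show "a \<inter> a' \<in> (\<Union>m. cyl t m)" by blast
qed

lemma space_past [simp]: "space (past t) = space M"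
  unfolding past_def by (rule space_measure_of) (auto simp: cyl_def)

lemma sets_past: "sets (past t) = sigma_sets (space M) (\<Union>m. cyl t m)"
  unfolding past_def by (rule sets_measure_of) (auto simp: cyl_def)

lemma past_events: "0 \<le> t \<Longrightarrow> A \<in> sets (past t) \<Longrightarrow> A \<in> events"
  using sets.sigma_sets_subset[of "\<Union>m. cyl t m" M] cyl_events unfolding sets_past by blast

text \<open>Grid values are partial sums of the first 2^m increments of a partition whose last
  increment is \<open>W T - W t\<close>; grouping independent increments gives the product
  rule.\<close>

lemma indep_grid_increment:
  assumes "0 < t" "t < T"
    and A: "A \<in> sets (\<Pi>\<^sub>M i\<in>{..2 ^ m}. borel)" and B: "B \<in> sets borel"
  shows "prob ((grid t m -` A \<inter> space M) \<inter> ((\<lambda>\<omega>. W T \<omega> - W t \<omega>) -` B \<inter> space M)) =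
    prob (grid t m -` A \<inter> space M) * prob ((\<lambda>\<omega>. W T \<omega> - W t \<omega>) -` B \<inter> space M)"
proof -
  \<comment> \<open>The grid of [0, t] with T appended: \<open>p (2 ^ m) = t\<close>, so increment
    number 2^m is the future one.\<close>
  define p where "p i = (if i \<le> 2 ^ m then real i * t / 2 ^ m else T)" for i :: nat
  define X where "X i \<omega> = W (p (Suc i)) \<omega> - W (p i) \<omega>" for i \<omega>
  have p: "p i < p (Suc i)" if "i < Suc (2 ^ m)" for i
  proof (cases "i = 2 ^ m")
    case True then show ?thesis using assms by (simp add: p_def)
  next
    case False
    then have "Suc i \<le> 2 ^ m" using that by simp
    then show ?thesis using assms by (simp add: p_def divide_strict_right_mono)
  qed
  have "indep_vars (\<lambda>_. borel) X {..<Suc (2 ^ m)}"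
    unfolding X_def by (rule indep_increments[where p=p]) (simp add: p_def, rule p)
  then have "indep_var (PiM {..<2 ^ m} (\<lambda>_. borel)) (\<lambda>\<omega>. restrict (\<lambda>i. X i \<omega>) {..<2 ^ m})
      (PiM {2 ^ m} (\<lambda>_. borel)) (\<lambda>\<omega>. restrict (\<lambda>i. X i \<omega>) {2 ^ m})"
    by (rule indep_var_restrict) auto
  then have "indep_var (\<Pi>\<^sub>M i\<in>{..2 ^ m}. borel)
      ((\<lambda>x. \<lambda>i\<in>{..2 ^ m}. \<Sum>l<i. x l) \<circ> (\<lambda>\<omega>. restrict (\<lambda>i. X i \<omega>) {..<2 ^ m}))
      (PiM {2 ^ m} (\<lambda>_. borel)) (id \<circ> (\<lambda>\<omega>. restrict (\<lambda>i. X i \<omega>) {2 ^ m}))"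
    by (rule indep_var_compose)
       (auto intro!: measurable_restrict borel_measurable_sum measurable_component_singleton)
  also have "(\<lambda>x. \<lambda>i\<in>{..2 ^ m}. \<Sum>l<i. x l) \<circ> (\<lambda>\<omega>. restrict (\<lambda>i. X i \<omega>) {..<2 ^ m}) = grid t m"
  proof (intro ext)
    fix \<omega> and i :: nat
    have "(\<Sum>l<i. restrict (\<lambda>i. X i \<omega>) {..<2 ^ m} l) = W (real i * t / 2 ^ m) \<omega>" if "i \<le> 2 ^ m"
    proof -
      have "(\<Sum>l<i. restrict (\<lambda>i. X i \<omega>) {..<2 ^ m} l) = (\<Sum>l<i. W (p (Suc l)) \<omega> - W (p l) \<omega>)"
        using that by (intro sum.cong) (auto simp: X_def)
      also have "\<dots> = W (p i) \<omega> - W (p 0) \<omega>" by (rule sum_lessThan_telescope)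
      finally show ?thesis using that by (simp add: p_def W_0)
    qed
    then show "((\<lambda>x. \<lambda>i\<in>{..2 ^ m}. \<Sum>l<i. x l) \<circ> (\<lambda>\<omega>. restrict (\<lambda>i. X i \<omega>) {..<2 ^ m})) \<omega> i = grid t m \<omega> i"
      by (simp add: grid_def)
  qed
  finally have ind: "indep_var (\<Pi>\<^sub>M i\<in>{..2 ^ m}. borel) (grid t m)
      (PiM {2 ^ m} (\<lambda>_. borel)) (\<lambda>\<omega>. restrict (\<lambda>i. X i \<omega>) {2 ^ m})"
    unfolding o_def id_def .
  let ?B = "(\<lambda>x. x (2 ^ m)) -` B \<inter> space (PiM {2 ^ m} (\<lambda>_::nat. borel))"
  have "?B \<in> sets (PiM {2 ^ m} (\<lambda>_. borel))"
    using B by (intro measurable_sets[OF measurable_component_singleton]) auto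
  from indep_varD[OF ind A this]
  have "prob ((\<lambda>\<omega>. (grid t m \<omega>, restrict (\<lambda>i. X i \<omega>) {2 ^ m})) -` (A \<times> ?B) \<inter> space M) =
    prob (grid t m -` A \<inter> space M) * prob ((\<lambda>\<omega>. restrict (\<lambda>i. X i \<omega>) {2 ^ m}) -` ?B \<inter> space M)" .
  moreover have "(\<lambda>\<omega>. restrict (\<lambda>i. X i \<omega>) {2 ^ m}) -` ?B \<inter> space M = (\<lambda>\<omega>. W T \<omega> - W t \<omega>) -` B \<inter> space M"
    using assms by (auto simp: X_def p_def space_PiM)
  moreover have "(\<lambda>\<omega>. (grid t m \<omega>, restrict (\<lambda>i. X i \<omega>) {2 ^ m})) -` (A \<times> ?B) \<inter> space M =
    (grid t m -` A \<inter> space M) \<inter> ((\<lambda>\<omega>. restrict (\<lambda>i. X i \<omega>) {2 ^ m}) -` ?B \<inter> space M)"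
    by auto
  ultimately show ?thesis by simp
qed

text \<open>Both generators are closed under intersection, so the product rule for cylinder events
  extends to the generated sigma-algebras.\<close>

lemma indep_past_increment:
  assumes "0 < t" "t < T"
  shows "indep_set (sets (past t))
    (sigma_sets (space M) {(\<lambda>\<omega>. W T \<omega> - W t \<omega>) -` B \<inter> space M | B. B \<in> sets borel})"
  unfolding sets_past
proof (rule indep_set_sigma_sets)
  let ?Y = "{(\<lambda>\<omega>. W T \<omega> - W t \<omega>) -` B \<inter> space M | B. B \<in> sets borel}"
  show "Int_stable ?Y"
  proof (rule Int_stableI)
    fix a a' assume "a \<in> ?Y" "a' \<in> ?Y"
    then obtain B B' where "B \<in> sets borel" "B' \<in> sets borel" "a = (\<lambda>\<omega>. W T \<omega> - W t \<omega>) -` B \<inter> space M"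
       "a' = (\<lambda>\<omega>. W T \<omega> - W t \<omega>) -` B' \<inter> space M" by blast
    then show "a \<inter> a' \<in> ?Y" by (intro CollectI exI[of _ "B \<inter> B'"]) auto
  qed
  show "indep_set (\<Union>m. cyl t m) ?Y"
  proof (rule indep_setI)
    show "(\<Union>m. cyl t m) \<subseteq> events" using cyl_events assms by (simp add: UN_least)
    have "(\<lambda>\<omega>. W T \<omega> - W t \<omega>) \<in> borel_measurable M"
      using assms by (intro borel_measurable_diff rv) auto
    then show "?Y \<subseteq> events" by (auto intro: measurable_sets)
    fix a b assume "a \<in> (\<Union>m. cyl t m)" "b \<in> ?Y"
    then obtain m A B where "A \<in> sets (\<Pi>\<^sub>M i\<in>{..2 ^ m}. borel)" "a = grid t m -` A \<inter> space M"
      "B \<in> sets borel" "b = (\<lambda>\<omega>. W T \<omega> - W t \<omega>) -` B \<inter> space M"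
      unfolding cyl_def by auto
    then show "prob (a \<inter> b) = prob a * prob b"
      using indep_grid_increment[OF assms] by simp
  qed
qed (rule Int_stable_cyl)

text \<open>Dyadic multiples of t are covered by the cylinders, and continuity of paths reaches
  every other s. Hence nothing about the path up to t is lost by generating the past from dyadic
  times only.\<close>

lemma W_past_measurable:
  assumes "0 < t" "0 \<le> s" "s \<le> t"
  shows "W s \<in> borel_measurable (past t)"
proof -
  have dyadic: "W (real i * t / 2 ^ m) \<in> borel_measurable (past t)" if "i \<le> 2 ^ m" for i m
  proof (rule measurableI)
    fix B :: "real set" assume B: "B \<in> sets borel"
    let ?A = "(\<lambda>x. x i) -` B \<inter> space (\<Pi>\<^sub>M i\<in>{..2 ^ m}. borel)"
    have "?A \<in> sets (\<Pi>\<^sub>M i\<in>{..2 ^ m}. borel)"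
      using that B by (intro measurable_sets[OF measurable_component_singleton]) auto
    moreover have "W (real i * t / 2 ^ m) -` B \<inter> space M = grid t m -` ?A \<inter> space M"
      using that by (auto simp: grid_def space_PiM)
    ultimately have "W (real i * t / 2 ^ m) -` B \<inter> space M \<in> cyl t m"
      unfolding cyl_def by blast
    then show "W (real i * t / 2 ^ m) -` B \<inter> space (past t) \<in> sets (past t)"
      unfolding sets_past space_past by (intro sigma_sets.Basic) blast
  qed simp
  \<comment> \<open>Rounding down gives approximations \<open>d m\<close> \<le> s \<le> t, which
    remain points of the grid.\<close>
  define k where "k m = nat \<lfloor>s * 2 ^ m / t\<rfloor>" for m :: nat
  define d where "d m = real (k m) * t / 2 ^ m" for m
  have k: "real (k m) \<le> s * 2 ^ m / t" "s * 2 ^ m / t < real (k m) + 1" for m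
    using assms by (auto simp: k_def)
  have "k m \<le> 2 ^ m" for m
  proof -
    have "s * 2 ^ m / t \<le> 2 ^ m" using assms by (simp add: field_simps)
    then have "real (k m) \<le> 2 ^ m" using k(1)[of m] by linarith
    then show ?thesis by (metis of_nat_le_iff of_nat_numeral of_nat_power)
  qed
  then have dm: "W (d m) \<in> borel_measurable (past t)" for m
    unfolding d_def by (rule dyadic)
  have lim: "d \<longlonglongrightarrow> s"
  proof (rule real_tendsto_sandwich)
    have "s - t / 2 ^ m \<le> d m" for m
    proof -
      have "s * 2 ^ m \<le> t + t * real (k m)"
        using k(2)[of m] assms by (simp add: field_simps)
      then have "s * 2 ^ m / 2 ^ m \<le> (t + t * real (k m)) / 2 ^ m" by (intro divide_right_mono) auto
      then show ?thesis by (simp add: d_def add_divide_distrib mult.commute)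
    qed
    then show "\<forall>\<^sub>F m in sequentially. s - t / 2 ^ m \<le> d m" by simp
    show "\<forall>\<^sub>F m in sequentially. d m \<le> s"
      using k assms by (auto simp: d_def field_simps)
    have "(\<lambda>m. s - t * (1 / 2) ^ m) \<longlonglongrightarrow> s - t * 0"
      by (intro tendsto_intros LIMSEQ_power_zero) simp
    then show "(\<lambda>m. s - t / 2 ^ m) \<longlonglongrightarrow> s" by (simp add: power_divide)
  qed simp
  show ?thesis
  proof (rule borel_measurable_LIMSEQ_real[OF _ dm])
    fix \<omega> assume "\<omega> \<in> space (past t)"
    then have "continuous_on {0..} (\<lambda>t. W t \<omega>)" using continuous_paths by simp
    then show "(\<lambda>m. W (d m) \<omega>) \<longlonglongrightarrow> W s \<omega>"
      by (rule continuous_on_tendsto_compose[OF _ lim]) (use assms in \<open>auto simp: d_def\<close>)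
  qed
qed

lemma exp_W:
  fixes z :: complex
  assumes "0 \<le> s" "s < t"
  shows "integrable M (\<lambda>\<omega>. exp (z * of_real (W t \<omega> - W s \<omega>)))"
    and "(\<integral>\<omega>. exp (z * of_real (W t \<omega> - W s \<omega>)) \<partial>M) = exp (z\<^sup>2 * of_real (t - s) / 2)"
  using normal_complex_mgf[OF prob_space_axioms _ normal_increments[OF assms], of z] assms by auto

lemma integrable_exp_W:
  fixes z :: complex
  assumes "0 \<le> t"
  shows "integrable M (\<lambda>\<omega>. exp (z * of_real (W t \<omega>)))"
  using exp_W(1)[of 0 t z] assms by (cases "t = 0") (auto simp: W_0)

text \<open>The exponential at T splits into its value at t, which together with A is determined by
  the past, and a function of the independent increment, whose mean is the last factor.\<close>

lemma exp_W_past: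
  fixes z :: complex
  assumes t: "0 < t" "t \<le> T" and A: "A \<in> sets (past t)"
  shows "(\<integral>\<omega>. indicator A \<omega> *\<^sub>R exp (z * of_real (W T \<omega>)) \<partial>M) =
    (\<integral>\<omega>. indicator A \<omega> *\<^sub>R exp (z * of_real (W t \<omega>)) \<partial>M) * exp (z\<^sup>2 * of_real (T - t) / 2)"
proof (cases "t = T")
  case False
  with t have tT: "t < T" by simp
  define X where "X \<omega> = indicator A \<omega> *\<^sub>R exp (z * complex_of_real (W t \<omega>))" for \<omega>
  define Y where "Y \<omega> = exp (z * complex_of_real (W T \<omega> - W t \<omega>))" for \<omega>
  have [measurable]: "W t \<in> borel_measurable (past t)" using t by (intro W_past_measurable) auto
  have XP: "X \<in> borel_measurable (past t)" unfolding X_def using A by measurable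
  have AM[measurable]: "A \<in> events" by (rule past_events[OF _ A]) (use t in simp)
  have "indep_var borel X borel Y"
    unfolding indep_var_eq
  proof (intro conjI)
    show "X \<in> borel_measurable M"
    proof (rule measurableI)
      fix C :: "complex set" assume "C \<in> sets borel"
      from measurable_sets[OF XP this] show "X -` C \<inter> space M \<in> events"
        using t by (intro past_events[of t]) auto
    qed simp
    have [measurable]: "W T \<in> borel_measurable M" "W t \<in> borel_measurable M" by (rule rv, use t in simp)+
    show "Y \<in> borel_measurable M" unfolding Y_def by measurable
    have 1: "sigma_sets (space M) {X -` A \<inter> space M |A. A \<in> sets borel} \<subseteq> sets (past t)"
    proof -
      have "{X -` A \<inter> space M |A. A \<in> sets borel} \<subseteq> sets (past t)"
        using measurable_sets[OF XP] by auto
      from sets.sigma_sets_subset[OF this] show ?thesis by simp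
    qed
    have 2: "sigma_sets (space M) {Y -` A \<inter> space M |A. A \<in> sets borel} \<subseteq>
       sigma_sets (space M) {(\<lambda>\<omega>. W T \<omega> - W t \<omega>) -` B \<inter> space M | B. B \<in> sets borel}"
    proof (rule sigma_sets_mono')
      show "{Y -` A \<inter> space M |A. A \<in> sets borel} \<subseteq>
         {(\<lambda>\<omega>. W T \<omega> - W t \<omega>) -` B \<inter> space M | B. B \<in> sets borel}"
      proof safe
        fix C :: "complex set" assume C: "C \<in> sets borel"
        have "(\<lambda>x. exp (z * complex_of_real x)) \<in> borel_measurable borel" by measurable
        from measurable_sets[OF this C]
        show "\<exists>B. Y -` C \<inter> space M = (\<lambda>\<omega>. W T \<omega> - W t \<omega>) -` B \<inter> space M \<and> B \<in> sets borel"
          by (intro exI[of _ "(\<lambda>x. exp (z * complex_of_real x)) -` C"]) (auto simp: Y_def)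
      qed
    qed
    show "indep_set (sigma_sets (space M) {X -` A \<inter> space M |A. A \<in> sets borel})
      (sigma_sets (space M) {Y -` A \<inter> space M |A. A \<in> sets borel})"
      using indep_past_increment[OF t(1) tT] 1 2 unfolding indep_sets2_eq by blast
  qed
  moreover have "integrable M X"
    unfolding X_def using integrable_exp_W[of t z] t by (intro integrable_mult_indicator) auto
  moreover have "integrable M Y" unfolding Y_def using exp_W(1) t tT by simp
  ultimately have "(\<integral>\<omega>. X \<omega> * Y \<omega> \<partial>M) = (\<integral>\<omega>. X \<omega> \<partial>M) * (\<integral>\<omega>. Y \<omega> \<partial>M)"
    by (rule indep_var_lebesgue_integral)
  moreover have XY: "X \<omega> * Y \<omega> = indicator A \<omega> *\<^sub>R exp (z * of_real (W T \<omega>))" for \<omega>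
    by (simp add: X_def Y_def algebra_simps flip: exp_add)
  moreover have "(\<integral>\<omega>. Y \<omega> \<partial>M) = exp (z\<^sup>2 * of_real (T - t) / 2)"
    unfolding Y_def using exp_W(2) t tT by simp
  ultimately show ?thesis unfolding XY by (simp add: X_def)
qed simp

end

section \<open>First passage times and the Wald martingale\<close>

lemma first_passage_nonneg: "0 \<le> first_passage W b \<omega>"
  unfolding first_passage_def by (auto intro!: Inf_greatest)

lemma first_passage_le: "0 < s \<Longrightarrow> W s \<omega> \<le> b s \<Longrightarrow> first_passage W b \<omega> \<le> ereal s"
  unfolding first_passage_def by (auto intro!: Inf_lower)

text \<open>Hits at or after r and arbitrarily close to it give W \<le> b at r; the absence of hits
  in (0, r), nonempty because r > 0, gives the reverse inequality from the left.\<close>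

lemma first_passage_attained:
  assumes cont: "continuous_on {0..} (\<lambda>s. W s \<omega>)" and b: "continuous_on {0..} b"
    and r: "first_passage W b \<omega> = ereal r" "0 < r"
  shows "W r \<omega> = b r"
proof -
  define g where "g s = W s \<omega> - b s" for s
  have "continuous_on {0..} g" unfolding g_def by (intro continuous_intros cont b)
  then have g: "isCont g r" using r(2) by (simp add: continuous_on_interior)
  have "\<exists>s. r \<le> s \<and> s < r + 1 / Suc n \<and> g s \<le> 0" for n
  proof -
    have "first_passage W b \<omega> < ereal (r + 1 / Suc n)" unfolding r by simp
    then obtain s where s: "0 < s" "W s \<omega> \<le> b s" "s < r + 1 / Suc n"
      unfolding first_passage_def Inf_less_iff by auto
    moreover have "r \<le> s" using first_passage_le[of s W \<omega> b] s r by simp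
    ultimately show ?thesis by (auto simp: g_def)
  qed
  then obtain x where x: "\<And>n. r \<le> x n" "\<And>n. x n < r + 1 / Suc n" "\<And>n. g (x n) \<le> 0" by metis
  have "x \<longlonglongrightarrow> r"
  proof (rule real_tendsto_sandwich)
    show "\<forall>\<^sub>F n in sequentially. r \<le> x n" using x(1) by simp
    show "\<forall>\<^sub>F n in sequentially. x n \<le> r + 1 / Suc n"
      by (intro always_eventually allI less_imp_le[OF x(2)])
    show "(\<lambda>n. r + 1 / Suc n) \<longlonglongrightarrow> r"
      using tendsto_add[OF tendsto_const[of r] LIMSEQ_Suc[OF lim_1_over_n]] by simp
  qed simp
  then have "(\<lambda>n. g (x n)) \<longlonglongrightarrow> g r" by (rule isCont_tendsto_compose[OF g])
  then have 1: "g r \<le> 0" by (rule LIMSEQ_le_const2) (use x in auto)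
  have "(g \<longlongrightarrow> g r) (at_left r)" using g by (simp add: isCont_def filterlim_at_split)
  moreover have "\<forall>\<^sub>F s in at_left r. 0 \<le> g s"
    unfolding eventually_at_left_field
  proof (intro exI[of _ 0] conjI allI impI)
    fix s assume "0 < s" "s < r"
    then have "\<not> W s \<omega> \<le> b s" using first_passage_le[of s W \<omega> b] r by auto
    then show "0 \<le> g s" by (simp add: g_def)
  qed (fact r)
  ultimately have "0 \<le> g r" by (rule tendsto_lowerbound) simp
  with 1 show ?thesis by (simp add: g_def)
qed

text \<open>The infimum is a hit unless it is 0. The value 0 must be excluded because of
  \<open>t = 0\<close>: hits may accumulate at 0 although no positive time is \<le> 0.\<close>

lemma first_passage_le_iff:
  assumes cont: "continuous_on {0..} (\<lambda>s. W s \<omega>)" and b: "continuous_on {0..} b"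
    and "first_passage W b \<omega> \<noteq> 0"
  shows "first_passage W b \<omega> \<le> ereal t \<longleftrightarrow> (\<exists>s. 0 < s \<and> s \<le> t \<and> W s \<omega> \<le> b s)"
proof
  assume le: "first_passage W b \<omega> \<le> ereal t"
  then obtain r where r: "first_passage W b \<omega> = ereal r"
    using first_passage_nonneg[of W b \<omega>] by (cases "first_passage W b \<omega>") auto
  then have "0 < r" using assms(3) first_passage_nonneg[of W b \<omega>] by (simp add: zero_ereal_def)
  then show "\<exists>s. 0 < s \<and> s \<le> t \<and> W s \<omega> \<le> b s"
    using first_passage_attained[of W \<omega>, OF cont b r] le r by (intro exI[of _ r]) simp
next
  assume "\<exists>s. 0 < s \<and> s \<le> t \<and> W s \<omega> \<le> b s"
  then obtain s where "0 < s" "s \<le> t" "W s \<omega> \<le> b s" by blast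
  then show "first_passage W b \<omega> \<le> ereal t"
    using first_passage_le[of s W \<omega> b] by (meson ereal_less_eq(3) order_trans)
qed

text \<open>Testing strict inequalities bypasses attainment: the infimum is below a exactly if a hit
  occurs no later than some rational q < a.\<close>

lemma first_passage_measurable:
  assumes W: "\<And>s. 0 \<le> s \<Longrightarrow> W s \<in> borel_measurable N"
    and cont: "\<And>\<omega>. \<omega> \<in> space N \<Longrightarrow> continuous_on {0..} (\<lambda>s. W s \<omega>)"
    and b: "continuous_on {0..} b"
  shows "first_passage W b \<in> borel_measurable N"
proof (rule borel_measurableI_less)
  fix a :: ereal
  have eq: "first_passage W b \<omega> < a \<longleftrightarrow>
    (\<exists>q. ereal (real_of_rat q) < a \<and> (\<exists>s. 0 < s \<and> s \<le> real_of_rat q \<and> W s \<omega> \<le> b s))" for \<omega>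
  proof
    assume "first_passage W b \<omega> < a"
    then obtain s where s: "0 < s" "W s \<omega> \<le> b s" "ereal s < a"
      unfolding first_passage_def Inf_less_iff by auto
    obtain q where q: "ereal s < ereal (real_of_rat q)" "ereal (real_of_rat q) < a"
      using ereal_dense3[OF s(3)] by blast
    then have "s \<le> real_of_rat q" by simp
    with s q show "\<exists>q. ereal (real_of_rat q) < a \<and> (\<exists>s. 0 < s \<and> s \<le> real_of_rat q \<and> W s \<omega> \<le> b s)"
      by blast
  next
    assume "\<exists>q. ereal (real_of_rat q) < a \<and> (\<exists>s. 0 < s \<and> s \<le> real_of_rat q \<and> W s \<omega> \<le> b s)"
    then obtain q s where s: "ereal (real_of_rat q) < a" "0 < s" "s \<le> real_of_rat q" "W s \<omega> \<le> b s"
      by blast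
    have "first_passage W b \<omega> \<le> ereal s" using s by (intro first_passage_le)
    also have "\<dots> \<le> ereal (real_of_rat q)" using s by simp
    finally show "first_passage W b \<omega> < a" using s(1) by simp
  qed
  have "{\<omega> \<in> space N. \<exists>s. 0 < s \<and> s \<le> t \<and> W s \<omega> \<le> b s} \<in> sets N" for t
    by (rule hit_before_measurable[OF W cont b])
  then show "{\<omega> \<in> space N. first_passage W b \<omega> < a} \<in> sets N"
    unfolding eq by (intro sets.sets_Collect_countable_Ex sets.sets_Collect_conj) auto
qed

text \<open>Lets the Stieltjes measure of F be recognised as the law of \<tau>, so that the integral
  becomes an expectation.\<close>

lemma interval_measure_cdf:
  assumes "real_distribution N"
  shows "interval_measure (cdf N) = N"
proof (rule cdf_unique)
  interpret real_distribution N by fact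
  show "real_distribution (interval_measure (cdf N))"
    by (rule real_distribution_interval_measure)
       (auto intro: cdf_nondecreasing cdf_is_right_cont cdf_lim_at_bot cdf_lim_at_top_prob)
  show "cdf (interval_measure (cdf N)) = cdf N"
    by (rule cdf_interval_measure) (auto intro: cdf_nondecreasing cdf_is_right_cont cdf_lim_at_bot)
qed fact

section \<open>The Wald martingale and Chernoff's bound\<close>

context brownian_from_zero
begin

definition wald :: "complex \<Rightarrow> real \<Rightarrow> 'a \<Rightarrow> complex" where
  "wald \<alpha> t \<omega> = exp (- \<alpha> * of_real (W t \<omega>) - \<alpha>\<^sup>2 / 2 * of_real t)"

lemma wald_eq: "wald \<alpha> t \<omega> = exp (- \<alpha> * of_real (W t \<omega>)) * exp (- (\<alpha>\<^sup>2 / 2 * of_real t))"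
  unfolding wald_def by (simp flip: exp_add)

lemma wald_of_real: "wald (of_real a) t \<omega> = of_real (exp (- a * W t \<omega> - a\<^sup>2 / 2 * t))"
  unfolding wald_def by (simp flip: exp_of_real)

lemma norm_wald:
  "norm (wald \<alpha> t \<omega>) = exp (- Re \<alpha> * W t \<omega> + ((Im \<alpha>)\<^sup>2 - (Re \<alpha>)\<^sup>2) / 2 * t)"
  unfolding wald_def by (simp add: power2_eq_square field_simps)

lemma integrable_wald: "0 \<le> t \<Longrightarrow> integrable M (wald \<alpha> t)"
  unfolding wald_eq[abs_def] by (intro integrable_mult_left integrable_exp_W)

text \<open>The mean of the increment's exponential cancels exactly what the compensator changes
  between t and T. This is the martingale property in integrated form, free of conditional
  expectations.\<close>

lemma expectation_wald_past:
  assumes t: "0 < t" "t \<le> T" and A: "A \<in> sets (past t)"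
  shows "(\<integral>\<omega>. indicator A \<omega> *\<^sub>R wald \<alpha> T \<omega> \<partial>M) = (\<integral>\<omega>. indicator A \<omega> *\<^sub>R wald \<alpha> t \<omega> \<partial>M)"
proof -
  have 1: "(\<integral>\<omega>. indicator A \<omega> *\<^sub>R wald \<alpha> s \<omega> \<partial>M) =
    (\<integral>\<omega>. indicator A \<omega> *\<^sub>R exp (- \<alpha> * of_real (W s \<omega>)) \<partial>M) * exp (- (\<alpha>\<^sup>2 / 2 * of_real s))" for s
    unfolding wald_eq by (simp flip: integral_mult_left_zero mult_scaleR_left)
  have "exp ((- \<alpha>)\<^sup>2 * of_real (T - t) / 2) * exp (- (\<alpha>\<^sup>2 / 2 * complex_of_real T)) = exp (- (\<alpha>\<^sup>2 / 2 * of_real t))"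
    unfolding exp_add[symmetric] by (rule arg_cong[where f=exp]) (simp add: field_simps)
  then show ?thesis unfolding 1 exp_W_past[OF assms, of "- \<alpha>"] by (simp add: mult.assoc)
qed

lemma expectation_wald:
  assumes "0 < t"
  shows "(\<integral>\<omega>. wald \<alpha> t \<omega> \<partial>M) = 1"
proof -
  have "(\<integral>\<omega>. wald \<alpha> t \<omega> \<partial>M) = exp ((- \<alpha>)\<^sup>2 * of_real t / 2) * exp (- (\<alpha>\<^sup>2 / 2 * of_real t))"
    unfolding wald_eq integral_mult_left_zero using exp_W(2)[of 0 t "- \<alpha>"] assms by (simp add: W_0)
  also have "\<dots> = 1" unfolding exp_add[symmetric] by simp
  finally show ?thesis .
qed

lemma wald_tendsto:
  assumes "\<omega> \<in> space M" "x \<longlonglongrightarrow> r" "0 \<le> r" "\<And>n. 0 \<le> x n"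
  shows "(\<lambda>n. wald \<alpha> (x n) \<omega>) \<longlonglongrightarrow> wald \<alpha> r \<omega>"
proof -
  have "(\<lambda>n. W (x n) \<omega>) \<longlonglongrightarrow> W r \<omega>"
    by (rule continuous_on_tendsto_compose[OF continuous_paths[OF assms(1)] assms(2)]) (use assms in auto)
  then show ?thesis unfolding wald_def by (intro tendsto_intros assms(2))
qed

text \<open>Markov's inequality for the Wald martingale with parameter -K: on the line c + K t its
  exponent is K (c + K t) - K^2 t / 2 = K c + K^2 t / 2.\<close>

lemma prob_W_gt:
  assumes "0 < t" "0 < K"
  shows "prob {\<omega> \<in> space M. c + K * t < W t \<omega>} \<le> exp (- K * c) * exp (- K\<^sup>2 * t / 2)"
proof -
  have [measurable]: "W t \<in> borel_measurable M" using rv assms by simp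
  have "integrable M (\<lambda>\<omega>. Re (wald (of_real (- K)) t \<omega>))"
    using integrable_wald assms by (intro integrable_Re) simp
  then have int: "integrable M (\<lambda>\<omega>. exp (K * W t \<omega> - K\<^sup>2 / 2 * t))"
    unfolding wald_of_real by simp
  have "complex_of_real (\<integral>\<omega>. exp (K * W t \<omega> - K\<^sup>2 / 2 * t) \<partial>M) = (\<integral>\<omega>. wald (of_real (- K)) t \<omega> \<partial>M)"
    unfolding wald_of_real by simp
  then have E: "(\<integral>\<omega>. exp (K * W t \<omega> - K\<^sup>2 / 2 * t) \<partial>M) = 1"
    using expectation_wald[OF assms(1), of "of_real (- K)"] by (simp only: of_real_eq_1_iff)
  have "prob {\<omega> \<in> space M. c + K * t < W t \<omega>} \<le>
      prob {\<omega> \<in> space M. exp (K * c + K\<^sup>2 * t / 2) \<le> exp (K * W t \<omega> - K\<^sup>2 / 2 * t)}"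
  proof (rule finite_measure_mono)
    show "{\<omega> \<in> space M. c + K * t < W t \<omega>} \<subseteq>
       {\<omega> \<in> space M. exp (K * c + K\<^sup>2 * t / 2) \<le> exp (K * W t \<omega> - K\<^sup>2 / 2 * t)}"
    proof
      fix \<omega> assume \<omega>: "\<omega> \<in> {\<omega> \<in> space M. c + K * t < W t \<omega>}"
      then have "K * (c + K * t) \<le> K * W t \<omega>" using assms by simp
      then show "\<omega> \<in> {\<omega> \<in> space M. exp (K * c + K\<^sup>2 * t / 2) \<le> exp (K * W t \<omega> - K\<^sup>2 / 2 * t)}"
        using \<omega> by (simp add: power2_eq_square field_simps)
    qed
  qed measurable
  also have "\<dots> \<le> (\<integral>\<omega>. exp (K * W t \<omega> - K\<^sup>2 / 2 * t) \<partial>M) / exp (K * c + K\<^sup>2 * t / 2)"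
    by (rule integral_Markov_inequality_measure[OF int]) auto
  also have "\<dots> = exp (- (K * c + K\<^sup>2 * t / 2))"
    unfolding E exp_minus by (simp only: inverse_eq_divide)
  also have "\<dots> = exp (- K * c) * exp (- K\<^sup>2 * t / 2)"
    unfolding exp_add[symmetric] by simp
  finally show ?thesis .
qed

end

section \<open>Optional stopping at the first passage time\<close>

locale regular_passage = brownian_from_zero M W for M :: "'a measure" and W +
  fixes b :: "real \<Rightarrow> real"
  assumes b_cont: "continuous_on {0..} b"
    and b_class: "b \<in> boundary_class"
    and regular: "AE \<omega> in M. first_passage W b \<omega> \<noteq> 0"
begin

definition hit :: "real \<Rightarrow> 'a set" where
  "hit t = {\<omega> \<in> space M. \<exists>s. 0 < s \<and> s \<le> t \<and> W s \<omega> \<le> b s}"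

text \<open>A path that never meets the boundary gets the junk value 0, which the indicators of
  \<open>{0<..T}\<close> and \<open>{0<..}\<close> below discard.\<close>

definition \<tau> :: "'a \<Rightarrow> real" where
  "\<tau> \<omega> = real_of_ereal (first_passage W b \<omega>)"

definition payoff :: "complex \<Rightarrow> real \<Rightarrow> complex" where
  "payoff \<alpha> s = exp (- \<alpha> * of_real (b s) - \<alpha>\<^sup>2 / 2 * of_real s)"

lemma hit_mono: "s \<le> t \<Longrightarrow> hit s \<subseteq> hit t"
  unfolding hit_def by force

text \<open>The stopping time property of \<tau>. Allowing t \<le> u puts the difference of two
  hitting events into the past of the later time.\<close>

lemma hit_past: "0 < u \<Longrightarrow> t \<le> u \<Longrightarrow> hit t \<in> sets (past u)"
  unfolding hit_def
  using hit_before_measurable[of t W "past u" b] W_past_measurable[of u] continuous_paths b_cont by simp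

lemma hit_events [measurable]: "hit t \<in> events"
  unfolding hit_def by (rule hit_before_measurable) (use rv continuous_paths b_cont in auto)

lemma first_passage_rv [measurable]: "first_passage W b \<in> borel_measurable M"
  by (rule first_passage_measurable[OF rv continuous_paths b_cont])

lemma \<tau>_rv [measurable]: "\<tau> \<in> borel_measurable M"
  unfolding \<tau>_def by measurable

lemma \<tau>_nonneg: "0 \<le> \<tau> \<omega>"
  unfolding \<tau>_def by (simp add: first_passage_nonneg real_of_ereal_pos)

lemma hit_imp_\<tau>:
  assumes "\<omega> \<in> hit t" "first_passage W b \<omega> \<noteq> 0"
  shows "first_passage W b \<omega> = ereal (\<tau> \<omega>)" "0 < \<tau> \<omega>" "W (\<tau> \<omega>) \<omega> = b (\<tau> \<omega>)" "\<tau> \<omega> \<le> t"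
proof -
  have \<omega>: "\<omega> \<in> space M" using assms(1) by (simp add: hit_def)
  have le: "first_passage W b \<omega> \<le> ereal t"
    using assms first_passage_le_iff[of W \<omega> b t] continuous_paths[OF \<omega>] b_cont by (simp add: hit_def)
  then show 1: "first_passage W b \<omega> = ereal (\<tau> \<omega>)"
    unfolding \<tau>_def using first_passage_nonneg[of W b \<omega>] by (cases "first_passage W b \<omega>") auto
  then show 2: "0 < \<tau> \<omega>" using assms(2) \<tau>_nonneg[of \<omega>] by (auto simp: zero_ereal_def)
  show "W (\<tau> \<omega>) \<omega> = b (\<tau> \<omega>)"
    by (rule first_passage_attained[where b=b, OF continuous_paths[OF \<omega>] b_cont 1 2])
  show "\<tau> \<omega> \<le> t" using le 1 by simp
qed

lemma hit_iff_\<tau>: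
  assumes "\<omega> \<in> hit T" "first_passage W b \<omega> \<noteq> 0"
  shows "\<omega> \<in> hit t \<longleftrightarrow> \<tau> \<omega> \<le> t"
proof
  assume "\<tau> \<omega> \<le> t"
  then show "\<omega> \<in> hit t" using hit_imp_\<tau>[OF assms] assms(1) unfolding hit_def by auto
qed (rule hit_imp_\<tau>(4)[OF _ assms(2)])

lemma \<tau>_pos_imp_hit:
  assumes "\<omega> \<in> space M" "0 < \<tau> \<omega>" "\<tau> \<omega> \<le> t"
  shows "\<omega> \<in> hit t"
proof -
  have 1: "first_passage W b \<omega> = ereal (\<tau> \<omega>)"
    using assms(2) unfolding \<tau>_def by (cases "first_passage W b \<omega>") auto
  have "W (\<tau> \<omega>) \<omega> = b (\<tau> \<omega>)"
    by (rule first_passage_attained[where b=b, OF continuous_paths[OF assms(1)] b_cont 1 assms(2)])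
  then show ?thesis using assms unfolding hit_def by auto
qed

section \<open>Consequences of membership in the boundary class\<close>

text \<open>With u = -1 the class puts b t above c + t, hence above c, for large t; before that,
  continuity on a compact interval bounds b.\<close>

lemma b_bounded_below: "\<exists>C. \<forall>t\<ge>0. - C \<le> b t"
proof -
  obtain c where c: "c < 0" "\<And>u. u < 0 \<Longrightarrow> \<forall>\<^sub>F t in at_top. b t + u * t > c"
    using b_class unfolding boundary_class_def by blast
  from c(2)[of "-1"] obtain t0 where t0: "\<And>t. t \<ge> t0 \<Longrightarrow> b t + -1 * t > c"
    unfolding eventually_at_top_linorder by auto
  have "compact (b ` {0..t0})"
    by (intro compact_continuous_image continuous_on_subset[OF b_cont]) auto
  from compact_imp_bounded[OF this] obtain B where B: "\<And>x. x \<in> {0..t0} \<Longrightarrow> \<bar>b x\<bar> \<le> B"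
    unfolding bounded_iff by (auto simp del: atLeastAtMost_iff)
  have "- (max B (- c)) \<le> b t" if "t \<ge> 0" for t
    using that t0[of t] B[of t] by (cases "t \<le> t0") (auto simp: abs_le_iff)
  then show ?thesis by blast
qed

text \<open>A path without a hit up to t lies above b t at the single time t, and u = -K puts b t
  above c + K t eventually, where Chernoff's bound applies. As K is arbitrary, the tail of \<tau>
  beats every exponential.\<close>

lemma no_hit_prob:
  assumes "0 < K"
  shows "\<exists>C. \<forall>t\<ge>0. prob (space M - hit t) \<le> C * exp (- K\<^sup>2 * t / 2)"
proof -
  obtain c where c: "\<And>u. u < 0 \<Longrightarrow> \<forall>\<^sub>F t in at_top. b t + u * t > c"
    using b_class unfolding boundary_class_def by blast
  from c[of "- K"] assms obtain t1 where t1: "\<And>t. t \<ge> t1 \<Longrightarrow> b t + - K * t > c"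
    unfolding eventually_at_top_linorder by auto
  define t0 where "t0 = max 1 t1"
  \<comment> \<open>The first term is Chernoff's prefactor; the second covers t < t0, where a
    probability is at most 1 \<le> exp (K^2 (t0 - t) / 2).\<close>
  define C where "C = max (exp (- K * c)) (exp (K\<^sup>2 * t0 / 2))"
  have "prob (space M - hit t) \<le> C * exp (- K\<^sup>2 * t / 2)" if "t \<ge> 0" for t
  proof (cases "t \<ge> t0")
    case True
    then have t: "0 < t" "t \<ge> t1" by (auto simp: t0_def)
    have [measurable]: "W t \<in> borel_measurable M" using rv t by simp
    have "prob (space M - hit t) \<le> prob {\<omega> \<in> space M. c + K * t < W t \<omega>}"
    proof (rule finite_measure_mono)
      show "space M - hit t \<subseteq> {\<omega> \<in> space M. c + K * t < W t \<omega>}"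
      proof
        fix \<omega> assume \<omega>: "\<omega> \<in> space M - hit t"
        then have "b t < W t \<omega>" using t by (force simp: hit_def)
        then show "\<omega> \<in> {\<omega> \<in> space M. c + K * t < W t \<omega>}" using \<omega> t1[OF t(2)] by simp
      qed
    qed measurable
    also have "\<dots> \<le> exp (- K * c) * exp (- K\<^sup>2 * t / 2)" by (rule prob_W_gt[OF t(1) assms])
    also have "\<dots> \<le> C * exp (- K\<^sup>2 * t / 2)" by (simp add: C_def)
    finally show ?thesis .
  next
    case False
    then have "K\<^sup>2 * t \<le> K\<^sup>2 * t0" by (intro mult_left_mono) auto
    have "prob (space M - hit t) \<le> 1" by simp
    also have "1 \<le> exp (K\<^sup>2 * t0 / 2) * exp (- K\<^sup>2 * t / 2)"
      unfolding exp_add[symmetric] using \<open>K\<^sup>2 * t \<le> K\<^sup>2 * t0\<close> by simp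
    also have "\<dots> \<le> C * exp (- K\<^sup>2 * t / 2)" by (simp add: C_def)
    finally show ?thesis .
  qed
  then show ?thesis by blast
qed

section \<open>The passage time rounded up to a grid\<close>

text \<open>Hits begin in cell number k, which is open on the left and closed on the right. Counting
  \<open>Suc n\<close> cells keeps the divisor positive.\<close>

definition fresh :: "real \<Rightarrow> nat \<Rightarrow> nat \<Rightarrow> 'a set" where
  "fresh T n k = hit (real (Suc k) * T / Suc n) - hit (real k * T / Suc n)"

text \<open>On \<open>hit T\<close> this is the martingale at \<open>\<tau>\<close> rounded up to a multiple of \<open>T / Suc n\<close>;
  elsewhere it is 0.\<close>

definition stopped :: "complex \<Rightarrow> real \<Rightarrow> nat \<Rightarrow> 'a \<Rightarrow> complex" where
  "stopped \<alpha> T n \<omega> = (\<Sum>k<Suc n. indicator (fresh T n k) \<omega> *\<^sub>R wald \<alpha> (real (Suc k) * T / Suc n) \<omega>)"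

lemma hit_0: "hit 0 = {}" unfolding hit_def by auto

lemma fresh_past: "0 < T \<Longrightarrow> fresh T n k \<in> sets (past (real (Suc k) * T / Suc n))"
  unfolding fresh_def by (intro sets.Diff hit_past) (auto simp: divide_right_mono)

lemma fresh_events [measurable]: "fresh T n k \<in> events"
  unfolding fresh_def by measurable

text \<open>Telescoping along the increasing events \<open>hit\<close>, which start from the empty
  \<open>hit 0\<close> and end with \<open>hit T\<close>.\<close>

lemma sum_indicator_fresh:
  assumes "0 < T"
  shows "(\<Sum>k<Suc n. indicator (fresh T n k) \<omega>) = (indicator (hit T) \<omega> :: real)"
proof -
  have "(\<Sum>k<Suc n. indicator (fresh T n k) \<omega> :: real) =
      (\<Sum>k<Suc n. indicator (hit (real (Suc k) * T / Suc n)) \<omega> - indicator (hit (real k * T / Suc n)) \<omega>)"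
  proof (intro sum.cong refl)
    fix k
    have "hit (real k * T / Suc n) \<subseteq> hit (real (Suc k) * T / Suc n)"
      using assms by (intro hit_mono) (simp add: divide_right_mono)
    then show "(indicator (fresh T n k) \<omega> :: real) =
      indicator (hit (real (Suc k) * T / Suc n)) \<omega> - indicator (hit (real k * T / Suc n)) \<omega>"
      unfolding fresh_def by (auto simp: indicator_def)
  qed
  also have "\<dots> = indicator (hit (real (Suc n) * T / Suc n)) \<omega> - indicator (hit (real 0 * T / Suc n)) \<omega>"
    by (rule sum_lessThan_telescope)
  also have "\<dots> = indicator (hit T) \<omega>" by (simp add: hit_0 del: of_nat_Suc)
  finally show ?thesis .
qed

lemma fresh_disjoint:
  assumes "0 < T" "\<omega> \<in> fresh T n j" "\<omega> \<in> fresh T n k"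
  shows "j = k"
proof -
  have False if "\<omega> \<in> fresh T n j" "\<omega> \<in> fresh T n k" "j < k" for j k
  proof -
    have "hit (real (Suc j) * T / Suc n) \<subseteq> hit (real k * T / Suc n)"
      using assms(1) \<open>j < k\<close> by (intro hit_mono divide_right_mono mult_right_mono) auto
    then show False using that unfolding fresh_def by auto
  qed
  then show ?thesis using assms by (meson linorder_neqE_nat)
qed

text \<open>Collapses the sum in \<open>stopped\<close> to its one nonzero term. The quantifier over
  f lets one k serve the parameters \<alpha> and 2 Re \<alpha> together.\<close>

lemma fresh_cases:
  assumes "0 < T"
  obtains "\<omega> \<notin> hit T" "\<And>k. k < Suc n \<Longrightarrow> \<omega> \<notin> fresh T n k"
  | k where "\<omega> \<in> hit T" "k < Suc n" "\<omega> \<in> fresh T n k"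
    "\<And>f :: nat \<Rightarrow> 'b::real_vector. (\<Sum>j<Suc n. indicator (fresh T n j) \<omega> *\<^sub>R f j) = f k"
proof (cases "\<omega> \<in> hit T")
  case False
  then have 0: "(\<Sum>k<Suc n. indicator (fresh T n k) \<omega>) = (0 :: real)"
    unfolding sum_indicator_fresh[OF assms] by simp
  have "\<omega> \<notin> fresh T n k" if "k < Suc n" for k
    using 0 that by (subst (asm) sum_nonneg_eq_0_iff) (auto simp: indicator_eq_0_iff)
  then show ?thesis using False that(1) by blast
next
  case True
  then have "(\<Sum>k<Suc n. indicator (fresh T n k) \<omega>) = (1 :: real)"
    unfolding sum_indicator_fresh[OF assms] by simp
  then obtain k where k: "k < Suc n" "\<omega> \<in> fresh T n k"
    by (metis (no_types, lifting) indicator_simps(2) lessThan_iff sum.neutral zero_neq_one)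
  have "(\<Sum>j<Suc n. indicator (fresh T n j) \<omega> *\<^sub>R f j) = f k" for f :: "nat \<Rightarrow> 'b"
  proof -
    have "(\<Sum>j<Suc n. indicator (fresh T n j) \<omega> *\<^sub>R f j) = (\<Sum>j<Suc n. if j = k then f j else 0)"
    proof (intro sum.cong refl)
      fix j
      show "indicator (fresh T n j) \<omega> *\<^sub>R f j = (if j = k then f j else 0)"
      proof (cases "j = k")
        case False
        then have "\<omega> \<notin> fresh T n j" using fresh_disjoint[OF assms _ k(2)] by blast
        then show ?thesis using False by simp
      qed (use k(2) in simp)
    qed
    also have "\<dots> = f k" using k(1) by simp
    finally show ?thesis .
  qed
  then show ?thesis by (rule that(2)[OF True k])
qed

lemma integrable_stopped: "0 < T \<Longrightarrow> integrable M (stopped \<alpha> T n)"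
  unfolding stopped_def[abs_def]
  by (intro Bochner_Integration.integrable_sum integrable_mult_indicator integrable_wald) auto

text \<open>Each \<open>fresh T n k\<close> lies in the past of its right endpoint, so the
  martingale can be carried from there to T, and the disjoint pieces add up to \<open>hit T\<close>.
  The result is the same for all n.\<close>

lemma expectation_stopped:
  assumes "0 < T"
  shows "(\<integral>\<omega>. stopped \<alpha> T n \<omega> \<partial>M) = (\<integral>\<omega>. indicator (hit T) \<omega> *\<^sub>R wald \<alpha> T \<omega> \<partial>M)"
proof -
  have le: "real (Suc k) * T / Suc n \<le> T" if "k < Suc n" for k
  proof -
    have "real (Suc k) * T \<le> real (Suc n) * T" using that assms by (intro mult_right_mono) auto
    then show ?thesis by (simp add: field_simps)
  qed
  have "(\<integral>\<omega>. stopped \<alpha> T n \<omega> \<partial>M) =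
      (\<Sum>k<Suc n. \<integral>\<omega>. indicator (fresh T n k) \<omega> *\<^sub>R wald \<alpha> (real (Suc k) * T / Suc n) \<omega> \<partial>M)"
    unfolding stopped_def using assms
    by (intro Bochner_Integration.integral_sum integrable_mult_indicator integrable_wald) auto
  also have "\<dots> = (\<Sum>k<Suc n. \<integral>\<omega>. indicator (fresh T n k) \<omega> *\<^sub>R wald \<alpha> T \<omega> \<partial>M)"
    using assms by (intro sum.cong refl expectation_wald_past[symmetric] fresh_past le) auto
  also have "\<dots> = (\<integral>\<omega>. (\<Sum>k<Suc n. indicator (fresh T n k) \<omega> *\<^sub>R wald \<alpha> T \<omega>) \<partial>M)"
    using assms
    by (intro Bochner_Integration.integral_sum[symmetric] integrable_mult_indicator integrable_wald) auto
  also have "\<dots> = (\<integral>\<omega>. indicator (hit T) \<omega> *\<^sub>R wald \<alpha> T \<omega> \<partial>M)"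
    unfolding scaleR_sum_left[symmetric] sum_indicator_fresh[OF assms] ..
  finally show ?thesis .
qed

text \<open>On each cell the squared modulus is exp (|\<alpha>|^2 s) times the Wald martingale with
  parameter 2 Re \<alpha>, and s \<le> T. The latter, stopped in the same way, has mean at most
  1.\<close>

lemma stopped_L2:
  assumes "0 < T"
  shows "integrable M (\<lambda>\<omega>. (norm (stopped \<alpha> T n \<omega>))\<^sup>2)"
    and "(\<integral>\<omega>. (norm (stopped \<alpha> T n \<omega>))\<^sup>2 \<partial>M) \<le> exp ((norm \<alpha>)\<^sup>2 * T)"
proof -
  define a where "a = 2 * Re \<alpha>"
  define Z where "Z \<omega> = Re (stopped (of_real a) T n \<omega>)" for \<omega>
  have intZ: "integrable M Z"
    unfolding Z_def[abs_def] using integrable_stopped[OF assms] by (intro integrable_Re)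
  have le: "(norm (stopped \<alpha> T n \<omega>))\<^sup>2 \<le> exp ((norm \<alpha>)\<^sup>2 * T) * Z \<omega>" for \<omega>
  proof (cases rule: fresh_cases[OF assms, of \<omega> n, where 'b=complex])
    case 1
    then show ?thesis by (simp add: Z_def stopped_def)
  next
    case (2 k)
    define s where "s = real (Suc k) * T / Suc n"
    have s: "0 \<le> s" "s \<le> T" using assms 2(2)
      by (auto simp: s_def field_simps intro!: mult_right_mono)
    have "(norm (stopped \<alpha> T n \<omega>))\<^sup>2 = (norm (wald \<alpha> s \<omega>))\<^sup>2"
      unfolding stopped_def 2(4) s_def ..
    also have "\<dots> = exp (- a * W s \<omega> - a\<^sup>2 / 2 * s + (norm \<alpha>)\<^sup>2 * s)"
      unfolding norm_wald cmod_power2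
      by (simp add: a_def power2_eq_square field_simps flip: exp_add)
    also have "\<dots> \<le> exp (- a * W s \<omega> - a\<^sup>2 / 2 * s + (norm \<alpha>)\<^sup>2 * T)"
      using s by (simp add: mult_left_mono)
    also have "\<dots> = exp ((norm \<alpha>)\<^sup>2 * T) * Z \<omega>"
      unfolding Z_def stopped_def 2(4) wald_of_real s_def exp_add by (simp del: of_nat_Suc)
    finally show ?thesis .
  qed
  have [measurable]: "stopped \<alpha> T n \<in> borel_measurable M"
    using integrable_stopped[OF assms] by (rule borel_measurable_integrable)
  show int: "integrable M (\<lambda>\<omega>. (norm (stopped \<alpha> T n \<omega>))\<^sup>2)"
  proof (rule Bochner_Integration.integrable_bound[where f="\<lambda>\<omega>. exp ((norm \<alpha>)\<^sup>2 * T) * Z \<omega>"])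
    show "AE \<omega> in M. norm ((norm (stopped \<alpha> T n \<omega>))\<^sup>2) \<le> norm (exp ((norm \<alpha>)\<^sup>2 * T) * Z \<omega>)"
    proof (rule AE_I2)
      fix \<omega>
      show "norm ((norm (stopped \<alpha> T n \<omega>))\<^sup>2) \<le> norm (exp ((norm \<alpha>)\<^sup>2 * T) * Z \<omega>)"
        using le[of \<omega>] by (simp only: real_norm_def abs_power2)
    qed
  qed (use intZ in auto)
  have "(\<integral>\<omega>. Z \<omega> \<partial>M) = Re (\<integral>\<omega>. indicator (hit T) \<omega> *\<^sub>R wald (of_real a) T \<omega> \<partial>M)"
    unfolding Z_def using integrable_stopped[OF assms] by (simp add: expectation_stopped[OF assms])
  also have "\<dots> = (\<integral>\<omega>. Re (indicator (hit T) \<omega> *\<^sub>R wald (of_real a) T \<omega>) \<partial>M)"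
    using assms by (intro integral_Re[symmetric] integrable_mult_indicator integrable_wald) auto
  \<comment> \<open>For a real parameter the martingale is positive, so dropping the indicator only
    increases the mean.\<close>
  also have "\<dots> \<le> (\<integral>\<omega>. Re (wald (of_real a) T \<omega>) \<partial>M)"
  proof (rule integral_mono)
    fix \<omega> show "Re (indicator (hit T) \<omega> *\<^sub>R wald (of_real a) T \<omega>) \<le> Re (wald (of_real a) T \<omega>)"
      unfolding wald_of_real by (simp add: indicator_def)
  qed (use assms in \<open>intro integrable_Re integrable_mult_indicator integrable_wald; simp\<close>)+
  also have "\<dots> = Re (\<integral>\<omega>. wald (of_real a) T \<omega> \<partial>M)"
    using assms by (intro integral_Re integrable_wald) auto
  also have "\<dots> = 1" unfolding expectation_wald[OF assms] by simp
  finally have Z1: "(\<integral>\<omega>. Z \<omega> \<partial>M) \<le> 1" .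
  have "(\<integral>\<omega>. (norm (stopped \<alpha> T n \<omega>))\<^sup>2 \<partial>M) \<le> (\<integral>\<omega>. exp ((norm \<alpha>)\<^sup>2 * T) * Z \<omega> \<partial>M)"
    by (rule integral_mono) (use int intZ le in auto)
  also have "\<dots> \<le> exp ((norm \<alpha>)\<^sup>2 * T) * 1"
    using Z1 by simp
  finally show "(\<integral>\<omega>. (norm (stopped \<alpha> T n \<omega>))\<^sup>2 \<partial>M) \<le> exp ((norm \<alpha>)\<^sup>2 * T)" by simp
qed

section \<open>Refining the grid at a fixed horizon\<close>

text \<open>Continuity of b is known on \<open>{0..}\<close> only; the indicator makes the function
  Borel on the whole line.\<close>

lemma payoff_measurable: "(\<lambda>s. indicator {0<..} s *\<^sub>R payoff \<alpha> s) \<in> borel_measurable borel"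
  unfolding payoff_def
  by (intro borel_measurable_continuous_on_indicator continuous_intros continuous_on_subset[OF b_cont]) auto

lemma norm_payoff: "norm (payoff \<alpha> s) = exp (- Re \<alpha> * b s + ((Im \<alpha>)\<^sup>2 - (Re \<alpha>)\<^sup>2) / 2 * s)"
  unfolding payoff_def by (simp add: power2_eq_square field_simps)

lemma norm_payoff_le:
  assumes "0 \<le> Re \<alpha>" "\<And>t. 0 \<le> t \<Longrightarrow> - C \<le> b t" "0 \<le> s"
  shows "norm (payoff \<alpha> s) \<le> exp (Re \<alpha> * C) * exp ((Im \<alpha>)\<^sup>2 / 2 * s)"
proof -
  have "- b s \<le> C" using assms(2)[OF assms(3)] by simp
  then have "Re \<alpha> * (- b s) \<le> Re \<alpha> * C" using assms(1) by (rule mult_left_mono)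
  moreover have "((Im \<alpha>)\<^sup>2 - (Re \<alpha>)\<^sup>2) / 2 * s \<le> (Im \<alpha>)\<^sup>2 / 2 * s"
    using assms by (intro mult_right_mono) auto
  ultimately show ?thesis unfolding norm_payoff exp_add[symmetric] by simp
qed

lemma expectation_payoff_upto:
  assumes "0 < T" "0 \<le> Re \<alpha>"
  shows "(\<integral>\<omega>. indicator {0<..T} (\<tau> \<omega>) *\<^sub>R payoff \<alpha> (\<tau> \<omega>) \<partial>M) =
    (\<integral>\<omega>. indicator (hit T) \<omega> *\<^sub>R wald \<alpha> T \<omega> \<partial>M)"
proof -
  define Y where "Y \<omega> = indicator {0<..T} (\<tau> \<omega>) *\<^sub>R payoff \<alpha> (\<tau> \<omega>)" for \<omega>
  obtain C where C: "\<And>t. 0 \<le> t \<Longrightarrow> - C \<le> b t" using b_bounded_below by blast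
  have "Y = (\<lambda>\<omega>. indicator {..T} (\<tau> \<omega>) *\<^sub>R (indicator {0<..} (\<tau> \<omega>) *\<^sub>R payoff \<alpha> (\<tau> \<omega>)))"
    by (auto simp: Y_def fun_eq_iff indicator_def)
  moreover have [measurable]: "(\<lambda>\<omega>. indicator {0<..} (\<tau> \<omega>) *\<^sub>R payoff \<alpha> (\<tau> \<omega>)) \<in> borel_measurable M"
    by (rule measurable_compose[OF \<tau>_rv payoff_measurable])
  ultimately have Y: "Y \<in> borel_measurable M" by (simp only:) measurable
  have "(\<lambda>n. \<integral>\<omega>. stopped \<alpha> T n \<omega> \<partial>M) \<longlonglongrightarrow> (\<integral>\<omega>. Y \<omega> \<partial>M)"
  proof (rule tendsto_expectation_L2_bounded[OF _ Y])
    show "stopped \<alpha> T n \<in> borel_measurable M" for n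
      using integrable_stopped[OF assms(1)] by (rule borel_measurable_integrable)
    show "norm (Y \<omega>) \<le> exp (Re \<alpha> * C) * exp ((Im \<alpha>)\<^sup>2 / 2 * T)" for \<omega>
    proof (cases "\<tau> \<omega> \<in> {0<..T}")
      case True
      then have "norm (Y \<omega>) \<le> exp (Re \<alpha> * C) * exp ((Im \<alpha>)\<^sup>2 / 2 * \<tau> \<omega>)"
        unfolding Y_def using norm_payoff_le[OF assms(2) C, of "\<tau> \<omega>"] by simp
      also have "\<dots> \<le> exp (Re \<alpha> * C) * exp ((Im \<alpha>)\<^sup>2 / 2 * T)"
        using True by (simp add: mult_left_mono divide_right_mono)
      finally show ?thesis .
    qed (simp add: Y_def)
    show "AE \<omega> in M. (\<lambda>n. stopped \<alpha> T n \<omega>) \<longlonglongrightarrow> Y \<omega>"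
      using regular AE_space
    proof eventually_elim
      case (elim \<omega>)
      show ?case
      proof (cases "\<omega> \<in> hit T")
        case False
        then have "\<tau> \<omega> \<notin> {0<..T}" using \<tau>_pos_imp_hit[of \<omega> T] elim by auto
        then have "Y \<omega> = 0" by (simp add: Y_def)
        moreover have "stopped \<alpha> T n \<omega> = 0" for n
        proof (cases rule: fresh_cases[OF assms(1), of \<omega> n, where 'b=complex])
          case 1
          then show ?thesis by (simp add: stopped_def)
        qed (use False in auto)
        ultimately show ?thesis by simp
      next
        case True
        define r where "r = \<tau> \<omega>"
        have r: "0 < r" "W r \<omega> = b r" "r \<le> T" using hit_imp_\<tau>[OF True elim(1)] by (auto simp: r_def)
        \<comment> \<open>The witness s is the right end of the cell containing r, which overshoots
          r by at most one mesh width.\<close>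
        have "\<exists>s. stopped \<alpha> T n \<omega> = wald \<alpha> s \<omega> \<and> r \<le> s \<and> s \<le> r + T / Suc n" for n
        proof (cases rule: fresh_cases[OF assms(1), of \<omega> n, where 'b=complex])
          case (2 k)
          have "r \<le> real (Suc k) * T / Suc n" "\<not> r \<le> real k * T / Suc n"
            using 2(3) hit_iff_\<tau>[OF True elim(1)] unfolding fresh_def r_def by auto
          moreover have "real (Suc k) * T / Suc n = real k * T / Suc n + T / Suc n"
            by (simp add: distrib_right add_divide_distrib)
          moreover have "stopped \<alpha> T n \<omega> = wald \<alpha> (real (Suc k) * T / Suc n) \<omega>"
            unfolding stopped_def 2(4) ..
          ultimately show ?thesis by (intro exI[of _ "real (Suc k) * T / Suc n"]) linarith
        qed (use True in auto)
        then obtain x where x: "\<And>n. stopped \<alpha> T n \<omega> = wald \<alpha> (x n) \<omega>" "\<And>n. r \<le> x n"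
            "\<And>n. x n \<le> r + T / Suc n" by metis
        have "x \<longlonglongrightarrow> r"
        proof (rule real_tendsto_sandwich)
          show "\<forall>\<^sub>F n in sequentially. r \<le> x n" using x(2) by simp
          show "\<forall>\<^sub>F n in sequentially. x n \<le> r + T / Suc n"
            by (intro always_eventually allI x(3))
          have "(\<lambda>n. r + T * (1 / Suc n)) \<longlonglongrightarrow> r + T * 0"
            by (intro tendsto_intros LIMSEQ_Suc[OF lim_1_over_n])
          then show "(\<lambda>n. r + T / Suc n) \<longlonglongrightarrow> r" by simp
        qed simp
        then have "(\<lambda>n. wald \<alpha> (x n) \<omega>) \<longlonglongrightarrow> wald \<alpha> r \<omega>"
          using wald_tendsto[OF elim(2), of x r] x(2) r(1) by (meson less_imp_le order_trans)
        moreover have "Y \<omega> = wald \<alpha> r \<omega>"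
          unfolding Y_def wald_def payoff_def r(2) using r by (simp add: r_def)
        ultimately show ?thesis unfolding x(1) by simp
      qed
    qed
  qed (use stopped_L2[OF assms(1)] in auto)
  \<comment> \<open>By \<open>expectation_stopped\<close> the convergent sequence is constant in n,
    so its value is the limit.\<close>
  then show ?thesis
    unfolding expectation_stopped[OF assms(1)] Y_def LIMSEQ_const_iff by (rule sym)
qed

end

section \<open>Letting the horizon tend to infinity\<close>

context regular_passage
begin

section \<open>Tail and exponential moments of \<tau>\<close>

text \<open>A path that never hits lies in every \<open>space M - hit n\<close>, and already K = 1
  makes these probabilities decay geometrically.\<close>

lemma AE_hit_eventually: "AE \<omega> in M. \<exists>n::nat. \<omega> \<in> hit (real n)"
proof -
  define N where "N = {\<omega> \<in> space M. \<forall>n::nat. \<omega> \<notin> hit (real n)}"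
  have [measurable]: "N \<in> events" unfolding N_def by measurable
  obtain C where C: "\<And>t. t \<ge> 0 \<Longrightarrow> prob (space M - hit t) \<le> C * exp (- 1\<^sup>2 * t / 2)"
    using no_hit_prob[of 1] by auto
  have "prob N \<le> 0"
  proof (rule LIMSEQ_le_const)
    have "(\<lambda>n. C * exp (- (1/2)) ^ n) \<longlonglongrightarrow> C * 0"
      by (intro tendsto_mult tendsto_const LIMSEQ_power_zero) simp
    then show "(\<lambda>n. C * exp (- (1/2)) ^ n) \<longlonglongrightarrow> 0" by simp
    have "prob N \<le> C * exp (- (1/2)) ^ n" for n
    proof -
      have "prob N \<le> prob (space M - hit (real n))"
        by (intro finite_measure_mono) (auto simp: N_def)
      also have "\<dots> \<le> C * exp (- (1/2)) ^ n"
        using C[of "real n"] by (simp flip: exp_of_nat_mult)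
      finally show ?thesis .
    qed
    then show "\<exists>k. \<forall>n\<ge>k. prob N \<le> C * exp (- (1/2)) ^ n" by blast
  qed
  then have "prob N = 0" using measure_nonneg[of M N] by linarith
  then have "N \<in> null_sets M" by (simp add: null_sets_def emeasure_eq_measure)
  then show ?thesis by (rule AE_I') (auto simp: N_def)
qed

lemma AE_first_passage_eq: "AE \<omega> in M. first_passage W b \<omega> = ereal (\<tau> \<omega>) \<and> 0 < \<tau> \<omega>"
  using AE_hit_eventually regular
proof eventually_elim
  case (elim \<omega>)
  then obtain n :: nat where "\<omega> \<in> hit (real n)" by blast
  then show ?case using hit_imp_\<tau>(1,2)[OF _ elim(2)] by simp
qed

text \<open>For \<gamma> \<ge> 0 the sum over n < \<tau> \<le> n + 1 is compared with the
  probability of no hit up to n. These moments dominate the payoff when the horizon is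
  removed.\<close>

lemma integrable_exp_\<tau>: "integrable M (\<lambda>\<omega>. indicator {0<..} (\<tau> \<omega>) * exp (\<gamma> * \<tau> \<omega>))"
proof (cases "0 \<le> \<gamma>")
  case True
  \<comment> \<open>Chosen so that K^2 / 2 = \<gamma> + 1: the tail beats exp (\<gamma> n) by a
    factor exp (- n).\<close>
  define K where "K = sqrt (2 * (\<gamma> + 1))"
  have K: "0 < K" "K\<^sup>2 = 2 * (\<gamma> + 1)" using True by (auto simp: K_def)
  obtain C where C: "\<And>t. t \<ge> 0 \<Longrightarrow> prob (space M - hit t) \<le> C * exp (- K\<^sup>2 * t / 2)"
    using no_hit_prob[OF K(1)] by auto
  define p where "p n = exp (\<gamma> * (real n + 1)) * prob (space M - hit (real n))" for n :: nat
  have p_le: "p n \<le> (exp \<gamma> * C) * exp (- 1) ^ n" for n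
  proof -
    have "p n \<le> exp (\<gamma> * (real n + 1)) * (C * exp (- K\<^sup>2 * real n / 2))"
      unfolding p_def by (intro mult_left_mono C) auto
    also have "\<dots> = C * exp (\<gamma> * (real n + 1) + (- K\<^sup>2 * real n / 2))"
      unfolding exp_add by simp
    also have "\<gamma> * (real n + 1) + (- K\<^sup>2 * real n / 2) = \<gamma> + real n * (- 1)"
      unfolding K(2) by (simp add: field_simps)
    also have "C * exp (\<gamma> + real n * (- 1)) = (exp \<gamma> * C) * exp (- 1) ^ n"
      unfolding exp_add exp_of_nat_mult by simp
    finally show ?thesis .
  qed
  have p0: "0 \<le> p n" for n by (simp add: p_def)
  have "summable (\<lambda>n. (exp \<gamma> * C) * exp (- 1 :: real) ^ n)"
    by (intro summable_mult summable_geometric) simp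
  then have "summable p"
    by (rule summable_comparison_test'[where N=0]) (use p_le p0 in auto)
  then have fin: "(\<Sum>n. ennreal (p n)) \<noteq> \<infinity>" using p0 by (simp add: ennreal_suminf_neq_top)
  show ?thesis
  proof (rule integrableI_bounded)
    have "(\<integral>\<^sup>+ \<omega>. ennreal (norm (indicator {0<..} (\<tau> \<omega>) * exp (\<gamma> * \<tau> \<omega>))) \<partial>M) \<le>
      (\<integral>\<^sup>+ \<omega>. (\<Sum>n. ennreal (exp (\<gamma> * (real n + 1))) * indicator (space M - hit (real n)) \<omega>) \<partial>M)"
    proof (rule nn_integral_mono_AE)
      show "AE \<omega> in M. ennreal (norm (indicator {0<..} (\<tau> \<omega>) * exp (\<gamma> * \<tau> \<omega>))) \<le>
        (\<Sum>n. ennreal (exp (\<gamma> * (real n + 1))) * indicator (space M - hit (real n)) \<omega>)"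
        using regular AE_space
      proof eventually_elim
        case (elim \<omega>)
        show ?case
        proof (cases "0 < \<tau> \<omega>")
          case True
          \<comment> \<open>Ceiling minus one makes n < \<tau> strict even at integers; with the
            floor, an integer \<tau> = n would already be a hit up to n.\<close>
          define n where "n = nat (\<lceil>\<tau> \<omega>\<rceil> - 1)"
          have n: "real n < \<tau> \<omega>" "\<tau> \<omega> \<le> real n + 1"
          proof -
            have "1 \<le> \<lceil>\<tau> \<omega>\<rceil>" using True by (simp add: one_le_ceiling)
            then have "real n = of_int \<lceil>\<tau> \<omega>\<rceil> - 1" by (simp add: n_def)
            then show "real n < \<tau> \<omega>" "\<tau> \<omega> \<le> real n + 1" by linarith+
          qed
          have "\<omega> \<notin> hit (real n)" using hit_imp_\<tau>(4)[of \<omega> "real n"] elim n(1) by auto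
          then have ind: "indicator (space M - hit (real n)) \<omega> = (1 :: ennreal)" using elim by simp
          have "norm (indicator {0<..} (\<tau> \<omega>) * exp (\<gamma> * \<tau> \<omega>)) \<le> exp (\<gamma> * (real n + 1))"
            using \<open>0 \<le> \<gamma>\<close> n(2) True by (simp add: mult_left_mono)
          then have "ennreal (norm (indicator {0<..} (\<tau> \<omega>) * exp (\<gamma> * \<tau> \<omega>))) \<le>
            ennreal (exp (\<gamma> * (real n + 1))) * indicator (space M - hit (real n)) \<omega>"
            unfolding ind by (simp add: ennreal_leI)
          also have "\<dots> \<le> (\<Sum>n. ennreal (exp (\<gamma> * (real n + 1))) * indicator (space M - hit (real n)) \<omega>)"
            using sum_le_suminf[of "\<lambda>n. ennreal (exp (\<gamma> * (real n + 1))) * indicator (space M - hit (real n)) \<omega>" "{n}"]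
            by (simp only: sum.insert sum.empty finite.intros empty_iff summableI zero_le simp_thms add_0_right)
          finally show ?thesis .
        qed simp
      qed
    qed
    also have "\<dots> = (\<Sum>n. \<integral>\<^sup>+ \<omega>. ennreal (exp (\<gamma> * (real n + 1))) * indicator (space M - hit (real n)) \<omega> \<partial>M)"
      by (rule nn_integral_suminf) measurable
    also have "\<dots> = (\<Sum>n. ennreal (p n))"
      by (intro suminf_cong) (simp add: nn_integral_cmult_indicator p_def emeasure_eq_measure ennreal_mult')
    also have "\<dots> < \<infinity>" using fin by (simp add: less_top)
    finally show "(\<integral>\<^sup>+ \<omega>. ennreal (norm (indicator {0<..} (\<tau> \<omega>) * exp (\<gamma> * \<tau> \<omega>))) \<partial>M) < \<infinity>" .
  qed measurable
next
  case False
  show ?thesis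
    by (rule integrable_const_bound[where B=1])
       (use False \<tau>_nonneg in \<open>auto simp: indicator_def mult_nonpos_nonneg\<close>)
qed

text \<open>Without a hit up to t the path is above b t \<ge> - L, so Re \<alpha> \<ge> 0 bounds the
  martingale by a constant times exp ((Im \<alpha>)^2 t / 2), uniformly on the event.\<close>

lemma expectation_no_hit_tendsto:
  assumes "0 \<le> Re \<alpha>"
  shows "(\<lambda>n. \<integral>\<omega>. indicator (space M - hit (real (Suc n))) \<omega> *\<^sub>R wald \<alpha> (real (Suc n)) \<omega> \<partial>M) \<longlonglongrightarrow> 0"
proof -
  obtain L where L: "\<And>t. 0 \<le> t \<Longrightarrow> - L \<le> b t" using b_bounded_below by blast
  \<comment> \<open>K^2 / 2 exceeds the growth rate (Im \<alpha>)^2 / 2 by exactly 1, which leaves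
    exp (- t).\<close>
  define K where "K = sqrt ((Im \<alpha>)\<^sup>2 + 2)"
  have K: "0 < K" "K\<^sup>2 = (Im \<alpha>)\<^sup>2 + 2" by (auto simp: K_def add_nonneg_pos)
  obtain C where C: "\<And>t. t \<ge> 0 \<Longrightarrow> prob (space M - hit t) \<le> C * exp (- K\<^sup>2 * t / 2)"
    using no_hit_prob[OF K(1)] by auto
  have bound: "norm (\<integral>\<omega>. indicator (space M - hit t) \<omega> *\<^sub>R wald \<alpha> t \<omega> \<partial>M) \<le> exp (Re \<alpha> * L) * C * exp (- t)"
    if t: "0 < t" for t
  proof -
    have "norm (\<integral>\<omega>. indicator (space M - hit t) \<omega> *\<^sub>R wald \<alpha> t \<omega> \<partial>M) \<le>
      (\<integral>\<omega>. norm (indicator (space M - hit t) \<omega> *\<^sub>R wald \<alpha> t \<omega>) \<partial>M)"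
      by (rule integral_norm_bound)
    also have "\<dots> \<le> (\<integral>\<omega>. exp (Re \<alpha> * L + (Im \<alpha>)\<^sup>2 / 2 * t) * indicator (space M - hit t) \<omega> \<partial>M)"
    proof (rule integral_mono)
      show "integrable M (\<lambda>\<omega>. norm (indicator (space M - hit t) \<omega> *\<^sub>R wald \<alpha> t \<omega>))"
        using t by (intro integrable_norm integrable_mult_indicator integrable_wald) auto
      show "integrable M (\<lambda>\<omega>. exp (Re \<alpha> * L + (Im \<alpha>)\<^sup>2 / 2 * t) * indicator (space M - hit t) \<omega>)"
        by (intro integrable_mult_right integrable_real_indicator) (auto simp: emeasure_eq_measure)
      fix \<omega> assume "\<omega> \<in> space M"
      show "norm (indicator (space M - hit t) \<omega> *\<^sub>R wald \<alpha> t \<omega>) \<le>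
        exp (Re \<alpha> * L + (Im \<alpha>)\<^sup>2 / 2 * t) * indicator (space M - hit t) \<omega>"
      proof (cases "\<omega> \<in> space M - hit t")
        case True
        then have "b t < W t \<omega>" using t by (force simp: hit_def)
        then have "- W t \<omega> \<le> L" using L[of t] t by simp
        then have "Re \<alpha> * (- W t \<omega>) \<le> Re \<alpha> * L" using assms by (rule mult_left_mono)
        moreover have "((Im \<alpha>)\<^sup>2 - (Re \<alpha>)\<^sup>2) / 2 * t \<le> (Im \<alpha>)\<^sup>2 / 2 * t"
          using t by (intro mult_right_mono) auto
        ultimately have "norm (wald \<alpha> t \<omega>) \<le> exp (Re \<alpha> * L + (Im \<alpha>)\<^sup>2 / 2 * t)"
          unfolding norm_wald by simp
        then show ?thesis using True by simp
      qed simp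
    qed
    also have "\<dots> = exp (Re \<alpha> * L + (Im \<alpha>)\<^sup>2 / 2 * t) * prob (space M - hit t)"
      by (simp add: Int_absorb2)
    also have "\<dots> \<le> exp (Re \<alpha> * L + (Im \<alpha>)\<^sup>2 / 2 * t) * (C * exp (- K\<^sup>2 * t / 2))"
      using t by (intro mult_left_mono C) auto
    also have "\<dots> = exp (Re \<alpha> * L) * C * exp ((Im \<alpha>)\<^sup>2 / 2 * t + - K\<^sup>2 * t / 2)"
      unfolding exp_add by simp
    also have "(Im \<alpha>)\<^sup>2 / 2 * t + - K\<^sup>2 * t / 2 = - t"
      unfolding K(2) by (simp add: field_simps)
    finally show ?thesis .
  qed
  show ?thesis
  proof (rule Lim_null_comparison)
    show "\<forall>\<^sub>F n in sequentially. norm (\<integral>\<omega>. indicator (space M - hit (real (Suc n))) \<omega> *\<^sub>R wald \<alpha> (real (Suc n)) \<omega> \<partial>M)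
        \<le> exp (Re \<alpha> * L) * C * exp (- 1) ^ Suc n"
      unfolding exp_of_nat_mult[symmetric]
      by (intro always_eventually allI order_trans[OF bound]) auto
    have "(\<lambda>n. exp (Re \<alpha> * L) * C * exp (- 1 :: real) ^ Suc n) \<longlonglongrightarrow> exp (Re \<alpha> * L) * C * 0"
      by (intro tendsto_mult tendsto_const LIMSEQ_Suc[OF LIMSEQ_power_zero]) simp
    then show "(\<lambda>n. exp (Re \<alpha> * L) * C * exp (- 1 :: real) ^ Suc n) \<longlonglongrightarrow> 0" by simp
  qed
qed

text \<open>At horizon T the mean is 1 minus the contribution of paths without a hit, which vanishes
  in the limit; the exponential moment of \<tau> of order (Im \<alpha>)^2 / 2 justifies removing the
  truncation.\<close>

lemma expectation_payoff:
  assumes "0 \<le> Re \<alpha>"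
  shows "(\<integral>\<omega>. indicator {0<..} (\<tau> \<omega>) *\<^sub>R payoff \<alpha> (\<tau> \<omega>) \<partial>M) = 1"
proof -
  define Y where "Y T \<omega> = indicator {0<..T} (\<tau> \<omega>) *\<^sub>R payoff \<alpha> (\<tau> \<omega>)" for T \<omega>
  define Z where "Z \<omega> = indicator {0<..} (\<tau> \<omega>) *\<^sub>R payoff \<alpha> (\<tau> \<omega>)" for \<omega>
  obtain L where L: "\<And>t. 0 \<le> t \<Longrightarrow> - L \<le> b t" using b_bounded_below by blast
  have Z[measurable]: "Z \<in> borel_measurable M"
    unfolding Z_def by (rule measurable_compose[OF \<tau>_rv payoff_measurable])
  have YZ: "Y T = (\<lambda>\<omega>. indicator {..T} (\<tau> \<omega>) *\<^sub>R Z \<omega>)" for T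
    by (auto simp: Y_def Z_def fun_eq_iff indicator_def)
  have bound: "norm (Z \<omega>) \<le> exp (Re \<alpha> * L) * (indicator {0<..} (\<tau> \<omega>) * exp ((Im \<alpha>)\<^sup>2 / 2 * \<tau> \<omega>))" for \<omega>
    using norm_payoff_le[OF assms L \<tau>_nonneg[of \<omega>]] by (auto simp: Z_def indicator_def)
  have "(\<lambda>n. \<integral>\<omega>. Y (real (Suc n)) \<omega> \<partial>M) \<longlonglongrightarrow> (\<integral>\<omega>. Z \<omega> \<partial>M)"
  proof (rule integral_dominated_convergence)
    show "Y (real (Suc n)) \<in> borel_measurable M" for n unfolding YZ by measurable
    show "integrable M (\<lambda>\<omega>. exp (Re \<alpha> * L) * (indicator {0<..} (\<tau> \<omega>) * exp ((Im \<alpha>)\<^sup>2 / 2 * \<tau> \<omega>)))"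
      by (intro integrable_mult_right integrable_exp_\<tau>)
    show "AE \<omega> in M. norm (Y (real (Suc n)) \<omega>) \<le>
        exp (Re \<alpha> * L) * (indicator {0<..} (\<tau> \<omega>) * exp ((Im \<alpha>)\<^sup>2 / 2 * \<tau> \<omega>))" for n
    proof (rule AE_I2)
      fix \<omega>
      have "norm (Y (real (Suc n)) \<omega>) \<le> norm (Z \<omega>)" unfolding YZ by (simp add: indicator_def)
      then show "norm (Y (real (Suc n)) \<omega>) \<le>
        exp (Re \<alpha> * L) * (indicator {0<..} (\<tau> \<omega>) * exp ((Im \<alpha>)\<^sup>2 / 2 * \<tau> \<omega>))"
        using bound[of \<omega>] by linarith
    qed
    show "AE \<omega> in M. (\<lambda>n. Y (real (Suc n)) \<omega>) \<longlonglongrightarrow> Z \<omega>"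
    proof (rule AE_I2)
      fix \<omega>
      obtain N where N: "\<tau> \<omega> \<le> real N" using real_arch_simple by blast
      have "\<forall>\<^sub>F n in sequentially. Z \<omega> = Y (real (Suc n)) \<omega>"
        unfolding eventually_sequentially YZ
        by (intro exI[of _ N] allI impI) (use N in auto)
      then show "(\<lambda>n. Y (real (Suc n)) \<omega>) \<longlonglongrightarrow> Z \<omega>"
        by (rule Lim_transform_eventually[OF tendsto_const])
    qed
  qed measurable
  moreover have "(\<integral>\<omega>. Y (real (Suc n)) \<omega> \<partial>M) =
    1 - (\<integral>\<omega>. indicator (space M - hit (real (Suc n))) \<omega> *\<^sub>R wald \<alpha> (real (Suc n)) \<omega> \<partial>M)" for n
  proof -
    define T where "T = real (Suc n)"
    have T: "0 < T" by (simp add: T_def)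
    have "(\<integral>\<omega>. indicator (hit T) \<omega> *\<^sub>R wald \<alpha> T \<omega> \<partial>M) +
      (\<integral>\<omega>. indicator (space M - hit T) \<omega> *\<^sub>R wald \<alpha> T \<omega> \<partial>M) =
      (\<integral>\<omega>. indicator (hit T) \<omega> *\<^sub>R wald \<alpha> T \<omega> + indicator (space M - hit T) \<omega> *\<^sub>R wald \<alpha> T \<omega> \<partial>M)"
      using T by (intro Bochner_Integration.integral_add[symmetric] integrable_mult_indicator integrable_wald) auto
    also have "\<dots> = (\<integral>\<omega>. wald \<alpha> T \<omega> \<partial>M)"
      by (intro Bochner_Integration.integral_cong refl) (auto simp: indicator_def)
    also have "\<dots> = 1" by (rule expectation_wald[OF T])
    finally show ?thesis
      unfolding Y_def T_def[symmetric] expectation_payoff_upto[OF T assms] by (simp add: algebra_simps)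
  qed
  ultimately have "(\<lambda>n. 1 - (\<integral>\<omega>. indicator (space M - hit (real (Suc n))) \<omega> *\<^sub>R wald \<alpha> (real (Suc n)) \<omega> \<partial>M))
      \<longlonglongrightarrow> (\<integral>\<omega>. Z \<omega> \<partial>M)" by simp
  moreover have "(\<lambda>n. 1 - (\<integral>\<omega>. indicator (space M - hit (real (Suc n))) \<omega> *\<^sub>R wald \<alpha> (real (Suc n)) \<omega> \<partial>M))
      \<longlonglongrightarrow> 1 - 0"
    by (intro tendsto_diff tendsto_const expectation_no_hit_tendsto[OF assms])
  ultimately have "(\<integral>\<omega>. Z \<omega> \<partial>M) = 1 - 0" by (rule LIMSEQ_unique)
  then show ?thesis unfolding Z_def by simp
qed

section \<open>The law of \<tau> and the Stieltjes integral\<close>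

text \<open>\<tau> is almost surely the genuine finite passage time, so the junk value 0 carries no
  mass and both versions have the same distribution function.\<close>

lemma interval_measure_passage_cdf: "interval_measure (passage_cdf M W b) = distr M borel \<tau>"
proof -
  have "passage_cdf M W b = cdf (distr M borel \<tau>)"
  proof
    fix t
    have "prob {\<omega> \<in> space M. first_passage W b \<omega> \<le> ereal t} = prob {\<omega> \<in> space M. \<tau> \<omega> \<le> t}"
    proof (rule finite_measure_eq_AE)
      show "AE \<omega> in M. \<omega> \<in> {\<omega> \<in> space M. first_passage W b \<omega> \<le> ereal t} \<longleftrightarrow> \<omega> \<in> {\<omega> \<in> space M. \<tau> \<omega> \<le> t}"
        using AE_first_passage_eq by eventually_elim auto
    qed measurable
    then show "passage_cdf M W b t = cdf (distr M borel \<tau>) t"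
      unfolding passage_cdf_def cdf_def by (subst measure_distr) (auto simp: vimage_def Int_def conj_commute)
  qed
  then show ?thesis using interval_measure_cdf[of "distr M borel \<tau>"] by simp
qed

lemma passage_integral:
  assumes "0 \<le> Re \<alpha>"
  shows "(LINT s:{0<..}|interval_measure (passage_cdf M W b).
    exp (- \<alpha> * of_real (b s) - \<alpha>\<^sup>2 / 2 * of_real s)) = 1"
  unfolding interval_measure_passage_cdf set_lebesgue_integral_def
  using expectation_payoff[OF assms] payoff_measurable[of \<alpha>] unfolding payoff_def
  by (subst integral_distr) auto

end

text \<open>Subtracting \<open>W 0\<close> leaves all increments unchanged and makes the start
  exact.\<close>

lemma (in standard_brownian_motion) brownian_from_zero_shift:
  "brownian_from_zero M (\<lambda>t \<omega>. W t \<omega> - W 0 \<omega>)"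
proof (intro_locales)
  show "standard_brownian_motion_axioms M (\<lambda>t \<omega>. W t \<omega> - W 0 \<omega>)"
  proof
    fix t :: real assume "0 \<le> t"
    then show "(\<lambda>\<omega>. W t \<omega> - W 0 \<omega>) \<in> borel_measurable M" by (intro borel_measurable_diff rv) auto
  next
    fix p :: "nat \<Rightarrow> real" and n
    assume "0 \<le> p 0" "\<And>i. i < n \<Longrightarrow> p i < p (Suc i)"
    from indep_increments[of p n, OF this]
    show "indep_vars (\<lambda>_. borel) (\<lambda>i \<omega>. W (p (Suc i)) \<omega> - W 0 \<omega> - (W (p i) \<omega> - W 0 \<omega>)) {..<n}" by simp
  next
    fix s t :: real assume "0 \<le> s" "s < t"
    from normal_increments[OF this]
    show "distributed M lborel (\<lambda>\<omega>. W t \<omega> - W 0 \<omega> - (W s \<omega> - W 0 \<omega>)) (normal_density 0 (sqrt (t - s)))" by simp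
  next
    fix \<omega> assume "\<omega> \<in> space M"
    then show "continuous_on {0..} (\<lambda>t. W t \<omega> - W 0 \<omega>)"
      by (intro continuous_intros continuous_paths)
  qed simp
  show "brownian_from_zero_axioms (\<lambda>t \<omega>. W t \<omega> - W 0 \<omega>)"
    by standard simp
qed

theorem theorem5:
  fixes M :: "'a measure" and W :: "real \<Rightarrow> 'a \<Rightarrow> real" and b :: "real \<Rightarrow> real"
    and \<alpha> :: complex
  assumes "standard_brownian_motion M W"
    and "continuous_on {0..} b"
    and "b 0 \<le> 0"
    and "b \<in> boundary_class"
    and "regular_boundary M W b"
    and "\<bar>Arg \<alpha>\<bar> \<le> pi / 2"
  shows "(LINT s:{0<..}|interval_measure (passage_cdf M W b).
           exp (- \<alpha> * of_real (b s) - \<alpha>\<^sup>2 / 2 * of_real s)) = 1"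
proof -
  interpret standard_brownian_motion M W by fact
  define V where "V t \<omega> = W t \<omega> - W 0 \<omega>" for t \<omega>
  interpret V: brownian_from_zero M V
    using brownian_from_zero_shift unfolding V_def[abs_def] .
  have [measurable]: "first_passage W b \<in> borel_measurable M"
    by (rule first_passage_measurable[OF rv continuous_paths assms(2)])
  have [measurable]: "first_passage V b \<in> borel_measurable M"
    by (rule first_passage_measurable[OF V.rv V.continuous_paths assms(2)])
  \<comment> \<open>V and W differ only on the null set where W does not start at 0, so F and
    regularity carry over from W to V.\<close>
  have same: "AE \<omega> in M. first_passage V b \<omega> = first_passage W b \<omega>"
    using start by eventually_elim (simp add: first_passage_def V_def)
  have cdf: "passage_cdf M W b = passage_cdf M V b"
  proof
    fix t
    show "passage_cdf M W b t = passage_cdf M V b t"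
      unfolding passage_cdf_def
    proof (rule finite_measure_eq_AE)
      show "AE \<omega> in M. \<omega> \<in> {\<omega> \<in> space M. first_passage W b \<omega> \<le> ereal t} \<longleftrightarrow>
          \<omega> \<in> {\<omega> \<in> space M. first_passage V b \<omega> \<le> ereal t}"
        using same by eventually_elim simp
    qed measurable
  qed
  have "AE \<omega> in M. first_passage W b \<omega> \<noteq> 0"
  proof (rule AE_I')
    show "{\<omega> \<in> space M. first_passage W b \<omega> = 0} \<in> null_sets M"
      using assms(5) unfolding regular_boundary_def by (auto simp: null_sets_def emeasure_eq_measure)
  qed auto
  with same have "AE \<omega> in M. first_passage V b \<omega> \<noteq> 0" by eventually_elim simp
  then interpret regular_passage M V b
    using assms by unfold_locales auto
  show ?thesis
    \<comment> \<open>The condition on the argument is exactly Re \<alpha> \<ge> 0; it includes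
      \<alpha> = 0, whose \<open>Arg\<close> is 0 by convention.\<close>
    unfolding cdf by (rule passage_integral) (use assms(6) in \<open>simp only: Arg_Re_nonneg\<close>)
qed

end
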